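(* Let $\widehat H_\diamond\in\mathcal A\cap\mathcal F_\diamond$ and let $S$ be the set of all $q\in\mathbb Z^n$ such that $\widehat H^q\ne0$. Suppose $$S\subset\{q\in\mathbb Z^n:\langle\omega,q\rangle\ge0\},\qquad \widehat H^0=\tfrac12\langle A\kappa,\kappa\rangle+O_3(\kappa),$$ where $A$ is a self-adjoint operator. Let $c$ be a positive constant. Assume that for any $\varepsilon>0$ there exists $q\in S$ such that $\omega_q\le\varepsilon|q|$ and $|Aq|>c|q|$. Then for any $\rho>0$ the norm $\|H_\diamond(\cdot,\delta)\|_\rho$, where $H_\diamond(\cdot,\delta)=\phi^\delta(\widehat H_\diamond)$, is unbounded as a function of $\delta\in[0,+\infty)$.
   Context: Let $n\ge1$ and let $\omega\in\mathbb R^n$ be nonresonant: $\langle q,\omega\rangle\ne0$ for all $q\in\mathbb Z^n\setminus\{0\}$. Let $z=(z_1,\dots,z_n)$, $\overline z=(\overline z_1,\dots,\overline z_n)$ be independent complex variables (the bar is not complex conjugation), $\mathbf z=(z,\overline z)$, $\kappa=(z_1\overline z_1,\dots,z_n\overline z_n)$. For $\mathbf k=(k,\overline k)\in\mathbb Z_+^{2n}$ put $\mathbf k'=\overline k-k\in\mathbb Z^n$, let $|\mathbf k|$ be the sum of all components, $\mathbf z^{\mathbf k}=z^k\overline z^{\overline k}$. For $q\in\mathbb Z^n$, $|q|=\sum_j|q_j|$, $\sigma_q=\operatorname{sign}\langle\omega,q\rangle$ ($\sigma_0=0$), $\omega_q=|\langle\omega,q\rangle|$. Let $\mathcal F_\diamond$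 be the space of formal power series $H_\diamond=\sum_{|\mathbf k|\ge3}H_{\mathbf k}\mathbf z^{\mathbf k}$ with complex coefficients; write $H^q=\sum_{\mathbf k'=q,\,|\mathbf k|\ge3}H_{\mathbf k}\mathbf z^{\mathbf k}$, so $H_\diamond=\sum_{q\in\mathbb Z^n}H^q$, and similarly $\widehat H_\diamond=\sum_q\widehat H^q$; $\widehat H^0$ is a power series in $\kappa$. $O_3(\kappa)$ denotes terms of degree at least $3$ in $\kappa$. The operator $A$ acts on $\mathbb R^n$ and is self-adjoint with respect to the standard inner product $\langle\cdot,\cdot\rangle$. For $\rho>0$ let $D_\rho=\{\mathbf z\in\mathbb C^{2n}:|z_j|<\rho,\ |\overline z_j|<\rho\}$; $\mathcal A^\rho$ is the space of power series converging to an analytic function on $D_\rho$ with finite norm $\|H\|_\rho=\sup_{D_\rho}|H|$ (a series not in $\mathcal A^\rho$ is regarded as having $\|\cdot\|_\rho=+\infty$); $\mathcal A=\bigcup_{\rho>0}\mathcal A^\rho$. Put $H_2=\sum_j\omega_jz_j\overline z_j$, $\{F,G\}=i\sum_{j=1}^n(\partial_{\overline z_j}F\,\partial_{z_j}G-\partial_{z_j}F\,\partial_{\overline z_j}G)$, $\xi H_\diamond=-i\sum_{|\mathbf k|\ge3}\sigma_{\mathbf k'}H_{\mathbf k}\mathbf z^{\mathbf k}$. $\phi^\delta(\widehat H_\diamond)$, $\delta\ge0$, is the value at $\delta$ of the unique solution in $\mathcal F_\diamond$ of $\partial_\delta H_\diamond=-\{\xi H_\diamond,H_2+H_\diamond\}$,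 $H_\diamond|_{\delta=0}=\widehat H_\diamond$, understood as an infinite ODE system for the coefficients. *)

theory Defs
  imports "HOL-Analysis.Analysis"
begin

text \<open>
  Formal power series in the \<open>2n\<close> independent variables \<open>(z, \<bar>z)\<close>, with \<open>n = CARD('n)\<close>, are families
  of complex coefficients. In a multi-index \<open>k\<close>, the first component consists of the exponents of
  the \<open>z\<^sub>j\<close> and the second one of the exponents of the \<open>\<bar>z\<^sub>j\<close>; likewise for points of the polydisc.
\<close>

type_synonym 'n midx = "(nat ^ 'n) \<times> (nat ^ 'n)"
type_synonym 'n series = "'n midx \<Rightarrow> complex"

definition rvec :: "int ^ 'n \<Rightarrow> real ^ 'n" where
  "rvec q = (\<chi> j. real_of_int (q $ j))"

definition l1_norm :: "real ^ 'n \<Rightarrow> real" where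
  "l1_norm x = (\<Sum>j\<in>UNIV. \<bar>x $ j\<bar>)"

definition nonresonant :: "real ^ 'n \<Rightarrow> bool" where
  "nonresonant \<omega> \<longleftrightarrow> (\<forall>q :: int ^ 'n. q \<noteq> 0 \<longrightarrow> \<omega> \<bullet> rvec q \<noteq> 0)"

definition midx_deg :: "'n::finite midx \<Rightarrow> nat" where
  "midx_deg k = (\<Sum>j\<in>UNIV. fst k $ j) + (\<Sum>j\<in>UNIV. snd k $ j)"

definition midx_diff :: "'n midx \<Rightarrow> int ^ 'n" where
  "midx_diff k = (\<chi> j. int (snd k $ j) - int (fst k $ j))"

definition F_diamond :: "'n::finite series set" where
  "F_diamond = {H. \<forall>k. midx_deg k < 3 \<longrightarrow> H k = 0}"

definition series_part :: "int ^ 'n \<Rightarrow> 'n series \<Rightarrow> 'n series" where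
  "series_part q H = (\<lambda>k. if midx_diff k = q then H k else 0)"

definition series_support :: "'n series \<Rightarrow> (int ^ 'n) set" where
  "series_support H = {q. series_part q H \<noteq> (\<lambda>k. 0)}"

definition series_mult :: "'n::finite series \<Rightarrow> 'n series \<Rightarrow> 'n series" where
  "series_mult F G = (\<lambda>k. \<Sum>(l, m) | l + m = k. F l * G m)"

text \<open>The sum defining the product is over a finite set, hence never 0 by default.\<close>

lemma finite_midx_splittings: "finite {(l, m). l + m = (k :: 'n::finite midx)}"
proof -
  let ?N = "midx_deg k"
  let ?B = "{v :: nat ^ 'n. \<forall>j. v $ j \<in> {..?N}}"
  have B: "finite ?B"
  proof -
    have "finite (vec_lambda ` (PiE (UNIV :: 'n set) (\<lambda>_. {..?N})))"
      by (intro finite_imageI finite_PiE) auto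
    moreover have "?B \<subseteq> vec_lambda ` (PiE UNIV (\<lambda>_. {..?N}))"
    proof
      fix v assume "v \<in> ?B"
      then show "v \<in> vec_lambda ` (PiE UNIV (\<lambda>_. {..?N}))"
        by (intro image_eqI[of _ _ "vec_nth v"]) auto
    qed
    ultimately show ?thesis by (rule rev_finite_subset)
  qed
  have le: "fst k $ j \<le> ?N" "snd k $ j \<le> ?N" for j
    using member_le_sum[of j UNIV "\<lambda>j. fst k $ j"] member_le_sum[of j UNIV "\<lambda>j. snd k $ j"]
    by (auto simp: midx_deg_def)
  have "a $ j \<le> ?N" "b $ j \<le> ?N" "c $ j \<le> ?N" "d $ j \<le> ?N"
    if "(a, b) + (c, d) = k" for a b c d j
    using le[of j] that by auto
  then have "{(l, m). l + m = k} \<subseteq> (?B \<times> ?B) \<times> (?B \<times> ?B)"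
    by auto
  then show ?thesis using B by (meson finite_SigmaI rev_finite_subset)
qed

definition d_z :: "'n \<Rightarrow> 'n::finite series \<Rightarrow> 'n series" where
  "d_z j F = (\<lambda>k. of_nat (fst k $ j + 1) * F (k + (axis j 1, 0)))"

definition d_zbar :: "'n \<Rightarrow> 'n::finite series \<Rightarrow> 'n series" where
  "d_zbar j F = (\<lambda>k. of_nat (snd k $ j + 1) * F (k + (0, axis j 1)))"

definition pbracket :: "'n::finite series \<Rightarrow> 'n series \<Rightarrow> 'n series" where
  "pbracket F G = (\<lambda>k. \<i> * (\<Sum>j\<in>UNIV.
      series_mult (d_zbar j F) (d_z j G) k - series_mult (d_z j F) (d_zbar j G) k))"

definition kappa :: "'n \<Rightarrow> 'n::finite series" where
  "kappa j = (\<lambda>k. if k = (axis j 1, axis j 1) then 1 else 0)"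

definition H_two :: "real ^ 'n \<Rightarrow> 'n::finite series" where
  "H_two \<omega> = (\<lambda>k. \<Sum>j\<in>UNIV. of_real (\<omega> $ j) * kappa j k)"

text \<open>The quadratic form \<open>\<langle>A \<kappa>, \<kappa>\<rangle>\<close> as a formal power series.\<close>

definition kappa_form :: "(real ^ 'n \<Rightarrow> real ^ 'n) \<Rightarrow> 'n::finite series" where
  "kappa_form A = (\<lambda>k. \<Sum>i\<in>UNIV. \<Sum>j\<in>UNIV.
      of_real (matrix A $ i $ j) * series_mult (kappa j) (kappa i) k)"

text \<open>Power series in \<open>\<kappa>\<close> all of whose terms have degree at least \<open>m\<close> in \<open>\<kappa>\<close>.\<close>

definition O_kappa :: "nat \<Rightarrow> 'n::finite series set" where
  "O_kappa m = {F. \<forall>k. F k \<noteq> 0 \<longrightarrow> fst k = snd k \<and> (\<Sum>j\<in>UNIV. fst k $ j) \<ge> m}"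

definition xi :: "real ^ 'n \<Rightarrow> 'n::finite series \<Rightarrow> 'n series" where
  "xi \<omega> H = (\<lambda>k. - \<i> * of_real (sgn (\<omega> \<bullet> rvec (midx_diff k))) * H k)"

definition flow_solution ::
  "real ^ 'n \<Rightarrow> 'n::finite series \<Rightarrow> (real \<Rightarrow> 'n series) \<Rightarrow> bool" where
  "flow_solution \<omega> H0 H \<longleftrightarrow>
     (\<forall>\<delta>\<ge>0. H \<delta> \<in> F_diamond) \<and> H 0 = H0 \<and>
     (\<forall>\<delta>\<ge>0. \<forall>k. ((\<lambda>s. H s k) has_vector_derivative
        - pbracket (xi \<omega> (H \<delta>)) (\<lambda>l. H_two \<omega> l + H \<delta> l) k) (at \<delta> within {0..}))"

text \<open>
  The solution exists and is unique on \<open>[0, \<infinity>)\<close> for every initial value in \<^const>\<open>F_diamond\<close>: the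
  coefficient at \<open>k\<close> satisfies a scalar linear equation whose inhomogeneity only involves
  coefficients of smaller degree. The values of a solution at negative times are irrelevant.
\<close>

definition phi :: "real ^ 'n \<Rightarrow> real \<Rightarrow> 'n::finite series \<Rightarrow> 'n series" where
  "phi \<omega> \<delta> H0 = (THE G. \<exists>H. flow_solution \<omega> H0 H \<and> G = H \<delta>)"

definition polydisc :: "real \<Rightarrow> ((complex ^ 'n) \<times> (complex ^ 'n)) set" where
  "polydisc \<rho> = {z. \<forall>j. cmod (fst z $ j) < \<rho> \<and> cmod (snd z $ j) < \<rho>}"

definition mono_eval :: "(complex ^ 'n) \<times> (complex ^ 'n) \<Rightarrow> 'n::finite midx \<Rightarrow> complex" where
  "mono_eval z k = (\<Prod>j\<in>UNIV. (fst z $ j) ^ (fst k $ j)) * (\<Prod>j\<in>UNIV. (snd z $ j) ^ (snd k $ j))"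

definition series_eval :: "'n::finite series \<Rightarrow> (complex ^ 'n) \<times> (complex ^ 'n) \<Rightarrow> complex" where
  "series_eval H z = (\<Sum>\<^sub>\<infinity>k. H k * mono_eval z k)"

text \<open>
  On an open polydisc, a multiple power series that converges at every point converges absolutely
  and locally uniformly, so its sum is automatically analytic.
\<close>

definition A_space :: "real \<Rightarrow> 'n::finite series set" where
  "A_space \<rho> = {H. (\<forall>z\<in>polydisc \<rho>. (\<lambda>k. H k * mono_eval z k) summable_on UNIV) \<and>
                   bounded (series_eval H ` polydisc \<rho>)}"

definition A_all :: "'n::finite series set" where
  "A_all = (\<Union>\<rho>\<in>{0<..}. A_space \<rho>)"

definition A_norm :: "real \<Rightarrow> 'n::finite series \<Rightarrow> ereal" where
  "A_norm \<rho> H =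
     (if H \<in> A_space \<rho> then (SUP z\<in>polydisc \<rho>. ereal (cmod (series_eval H z))) else \<infinity>)"

end

theory Submission
  imports Defs "HOL-Complex_Analysis.Conformal_Mappings"
begin

text \<open>
  As the support of the initial value lies in a half-space, the flow fixes \<open>H\<^sup>0 = f(\<kappa>)\<close>, and each
  \<open>H\<^sup>q\<close> with \<open>q \<noteq> 0\<close> satisfies the linear equation \<open>\<partial>\<^sub>\<delta> H\<^sup>q = - a H\<^sup>q\<close> with
  \<open>a = \<langle>\<omega>, q\<rangle> + \<langle>q, \<nabla>f(\<kappa>)\<rangle> = \<omega>\<^sub>q + \<langle>A q, \<kappa>\<rangle> + |q| O(|\<kappa>|\<^sup>2)\<close>, the last constant being uniform in \<open>q\<close>.
  If the norms stayed bounded by \<open>C\<close>, Cauchy's estimates would bound all coefficients uniformly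
  in \<open>\<delta>\<close>, so that on a smaller polydisc the equation can be summed to
  \<open>H\<^sup>q(z, \<delta>) = exp(- a(z) \<delta>) H\<^sup>q(z, 0)\<close>. Near \<open>\<kappa> = - \<sigma>\<^sup>2 sign(A q)\<close> with \<open>\<sigma>\<close> small and \<open>q\<close> chosen for
  \<open>\<epsilon> = c \<sigma>\<^sup>2 / 8\<close>, the real part of \<open>a\<close> is negative; boundedness then forces \<open>H\<^sup>q(z, 0) = 0\<close> on an open
  set, hence \<open>H\<^sup>q = 0\<close> initially, a contradiction.
\<close>

section \<open>Power series in several variables\<close>

text \<open>The flow is given only coefficient by coefficient, whereas growth shows only in the
  values of \<open>H^q\<close> at a point. Passing from one to the other needs a majorant uniform in
  \<delta>. The assumed norm bound supplies it through Cauchy's estimates, and the same majorant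
  then contradicts the growth, so boundedness enters twice. The passage from H to \<open>H^q\<close>
  is a selection of coefficients, which inherits their bounds at once.

  The order of choices is the delicate point. The vector q depends on the accuracy \<epsilon>, so
  \<sigma> has to be fixed before q, and the constant in the remainder must depend on C, R and n
  alone. This works because the multiplier a is linear in q: each derivative of f with respect to
  \<kappa>_j is estimated once and weighted by |q_j|, which produces the l1 norm.

  Independence of z and its bar is essential: only then can each \<kappa>_j be given either sign.
  For conjugate variables all \<kappa>_j are nonnegative, and the pairing of A q with \<kappa> could
  not be made negative if all components of A q were positive.\<close>

lemma summable_on_geometric_multi:
  fixes e :: "'k \<Rightarrow> 'i::finite \<Rightarrow> nat" and x :: real
  assumes e: "inj e" and x: "0 \<le> x" "x < 1"
  shows "(\<lambda>k. x ^ (\<Sum>i\<in>UNIV. e k i)) summable_on UNIV"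
proof (rule nonneg_bdd_above_summable_on)
  show "bdd_above (sum (\<lambda>k. x ^ (\<Sum>i\<in>UNIV. e k i)) ` {F. F \<subseteq> UNIV \<and> finite F})"
  proof (rule bdd_aboveI2)
    fix F :: "'k set" assume "F \<in> {F. F \<subseteq> UNIV \<and> finite F}"
    then have F: "finite F" by simp
    \<comment> \<open>N exceeds every exponent occurring in F. Injectivity of \<open>e\<close> then
      embeds F into a box, over which the sum factors into geometric sums in one variable, with a
      bound independent of F.\<close>
    define N where "N = Suc (Max (insert 0 ((\<lambda>(k, i). e k i) ` (F \<times> UNIV))))"
    have lt: "e k i < N" if "k \<in> F" for k i
      unfolding N_def less_Suc_eq_le by (rule Max_ge) (use F that in auto)
    have "(\<Sum>k\<in>F. x ^ (\<Sum>i\<in>UNIV. e k i)) = (\<Sum>h\<in>e ` F. x ^ (\<Sum>i\<in>UNIV. h i))"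
      using e by (subst sum.reindex) (auto intro: inj_on_subset)
    also have "\<dots> \<le> (\<Sum>h\<in>PiE (UNIV :: 'i set) (\<lambda>_. {..<N}). x ^ (\<Sum>i\<in>UNIV. h i))"
      by (rule sum_mono2) (use x lt in \<open>auto intro!: finite_PiE\<close>)
    also have "\<dots> = (\<Prod>i\<in>(UNIV :: 'i set). \<Sum>t<N. x ^ t)"
      by (subst prod_sum_PiE) (auto simp: power_sum)
    also have "\<dots> \<le> (\<Prod>i\<in>(UNIV :: 'i set). 1 / (1 - x))"
    proof (rule prod_mono)
      have "(\<Sum>t<N. x ^ t) \<le> (\<Sum>t. x ^ t)"
        using x by (intro sum_le_suminf summable_geometric) auto
      then show "0 \<le> (\<Sum>t<N. x ^ t) \<and> (\<Sum>t<N. x ^ t) \<le> 1 / (1 - x)"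
        using x by (simp add: suminf_geometric sum_nonneg)
    qed
    finally show "(\<Sum>k\<in>F. x ^ (\<Sum>i\<in>UNIV. e k i)) \<le> (\<Prod>i\<in>(UNIV :: 'i set). 1 / (1 - x))" .
  qed
qed (use x in auto)

lemma has_sum_sum:
  fixes f :: "'a \<Rightarrow> 'b \<Rightarrow> 'c::{topological_comm_monoid_add, t2_space}"
  assumes "\<And>a. a \<in> A \<Longrightarrow> (f a has_sum s a) B"
  shows "((\<lambda>b. \<Sum>a\<in>A. f a b) has_sum (\<Sum>a\<in>A. s a)) B"
  using assms by (induction A rule: infinite_finite_induct) (auto intro!: has_sum_add)

text \<open>The summands are the powers of x, an N-th root of unity that stands for the (m - k)-th
  power of \<zeta>. Both exponents lie below N, so N does not divide their nonzero difference; hence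
  x differs from 1 and its geometric sum vanishes.\<close>

lemma sum_roots_of_unity_character:
  fixes N m k :: nat
  defines "\<zeta> \<equiv> cis (2 * pi / N)"
  assumes "m < N" "k < N" "m \<noteq> k"
  shows "(\<Sum>t<N. (\<zeta> ^ t) ^ m * cnj (\<zeta> ^ t) ^ k) = 0"
proof -
  define x where "x = \<zeta> ^ m * cnj \<zeta> ^ k"
  have N: "N > 0" using assms by simp
  have root: "\<zeta> ^ j = 1 \<longleftrightarrow> N dvd j" for j
  proof -
    have "\<zeta> ^ j = exp (2 * of_real pi * \<i> * of_nat j / of_nat N)"
      by (simp add: \<zeta>_def cis_conv_exp exp_of_nat_mult [symmetric] mult_ac)
    then show ?thesis using complex_root_unity_eq_1[of N j] N by simp
  qed
  have unit: "\<zeta> * cnj \<zeta> = 1" by (simp add: \<zeta>_def cis_cnj cis_mult)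
  have "\<zeta> ^ N = 1" using root by simp
  moreover from this have "cnj \<zeta> ^ N = 1" by (metis complex_cnj_one complex_cnj_power)
  ultimately have xN: "x ^ N = 1"
    by (simp add: x_def power_mult_distrib power_mult [symmetric] mult.commute [of _ N])
       (simp add: power_mult)
  have "x \<noteq> 1"
  proof
    assume "x = 1"
    then have "\<zeta> ^ m * cnj \<zeta> ^ k * \<zeta> ^ k = \<zeta> ^ k" by (simp add: x_def)
    then have eq: "\<zeta> ^ m = \<zeta> ^ k"
      using unit by (metis (no_types) mult.assoc mult.commute mult.right_neutral power_mult_distrib power_one)
    have False if "a < b" "b < N" "\<zeta> ^ a = \<zeta> ^ b" for a b
    proof -
      have "\<zeta> ^ b = \<zeta> ^ a * \<zeta> ^ (b - a)" using that by (metis le_add_diff_inverse less_imp_le power_add)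
      moreover have "\<zeta> \<noteq> 0" using unit by auto
      ultimately have "\<zeta> ^ (b - a) = 1" using that by simp
      then have "N dvd b - a" by (simp add: root)
      then show False using that by (auto dest: dvd_imp_le)
    qed
    then show False using assms eq by (metis nat_neq_iff)
  qed
  have "(\<Sum>t<N. (\<zeta> ^ t) ^ m * cnj (\<zeta> ^ t) ^ k) = (\<Sum>t<N. x ^ t)"
    by (intro sum.cong) (simp_all add: x_def power_mult_distrib power_mult [symmetric] mult.commute)
  also have "\<dots> = 0" using \<open>x \<noteq> 1\<close> xN by (simp add: sum_gp_strict)
  finally show ?thesis .
qed

text \<open>
  Averaging over the points whose coordinates are \<open>r\<close> times \<open>N\<close>-th roots of unity isolates the
  coefficient at \<open>k\<close> up to the coefficients with some exponent at least \<open>N\<close>, whose total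
  contribution vanishes as \<open>N \<rightarrow> \<infinity>\<close>. This avoids multiple contour integrals.
\<close>

lemma Cauchy_estimate_multi:
  fixes e :: "'k \<Rightarrow> 'i::finite \<Rightarrow> nat" and H :: "'k \<Rightarrow> complex"
  assumes e: "inj e" and r: "r \<ge> 0"
    and sm: "(\<lambda>k. norm (H k) * r ^ (\<Sum>i\<in>UNIV. e k i)) summable_on UNIV"
    and bound: "\<And>z. (\<And>i. cmod (z i) = r) \<Longrightarrow> cmod (\<Sum>\<^sub>\<infinity>k. H k * (\<Prod>i\<in>UNIV. z i ^ e k i)) \<le> S"
  shows "norm (H k) * r ^ (\<Sum>i\<in>UNIV. e k i) \<le> S"
proof (rule field_le_epsilon)
  fix \<epsilon> :: real assume "\<epsilon> > 0"
  define g where "g = (\<lambda>m. norm (H m) * r ^ (\<Sum>i\<in>UNIV. e m i))"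
  have g0: "g m \<ge> 0" for m using r by (simp add: g_def)
  have gs: "g summable_on X" for X using sm summable_on_subset_banach[of g UNIV X] by (simp add: g_def)
  obtain F where F: "finite F" "dist (sum g F) (infsum g UNIV) \<le> \<epsilon>"
    using infsum_finite_approximation[OF gs \<open>\<epsilon> > 0\<close>, of UNIV] by blast
  \<comment> \<open>With N above all exponents of k and of the members of F, no two of these indices
    are confused by N-th roots of unity.\<close>
  define N where "N = Suc (Max (insert 0 ((\<lambda>(k, i). e k i) ` (insert k F \<times> UNIV))))"
  have lt: "e m i < N" if "m \<in> insert k F" for m i
    unfolding N_def less_Suc_eq_le by (rule Max_ge) (use F that in auto)
  have N: "N > 0" by (simp add: N_def)
  define \<zeta> where "\<zeta> = cis (2 * pi / N)"
  have nz: "cmod (\<zeta> ^ t) = 1" for t by (simp add: \<zeta>_def norm_power)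
  define T :: "('i \<Rightarrow> nat) set" where "T = PiE UNIV (\<lambda>_. {..<N})"
  have T: "finite T" "card T = N ^ CARD('i)" by (auto simp: T_def card_PiE intro!: finite_PiE)
  define w where "w = (\<lambda>(\<theta> :: 'i \<Rightarrow> nat) m. \<Prod>i\<in>UNIV. (\<zeta> ^ \<theta> i) ^ e m i)"
  have nw: "cmod (w \<theta> m) = 1" for \<theta> m
    by (simp add: w_def prod_norm [symmetric] norm_power \<zeta>_def)
  define h where "h = (\<lambda>m. H m * of_real r ^ (\<Sum>i\<in>UNIV. e m i))"
  have nh: "cmod (h m) = g m" for m using r by (simp add: h_def g_def norm_mult norm_power)
  have hs: "(\<lambda>m. h m * u m) summable_on UNIV" if "\<And>m. cmod (u m) \<le> 1" for u
    by (rule abs_summable_summable, rule Infinite_Sum.abs_summable_on_comparison_test'[OF gs])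
       (simp add: norm_mult nh mult_left_le that g0)
  \<comment> \<open>The average of a character over the grid T: it is 1 at k, 0 on the rest of F by
    orthogonality, and of modulus at most 1 everywhere.\<close>
  define c where "c = (\<lambda>m. (\<Sum>\<theta>\<in>T. w \<theta> m * cnj (w \<theta> k)) / N ^ CARD('i))"
  have c1: "cmod (c m) \<le> 1" for m
  proof -
    have "cmod (\<Sum>\<theta>\<in>T. w \<theta> m * cnj (w \<theta> k)) \<le> (\<Sum>\<theta>\<in>T. 1)"
      by (rule sum_norm_le) (simp add: norm_mult nw)
    also have "\<dots> = N ^ CARD('i)" using T by simp
    finally show ?thesis using N by (simp add: c_def norm_divide norm_power divide_simps)
  qed
  have ck: "c k = 1"
  proof -
    have "w \<theta> k * cnj (w \<theta> k) = 1" for \<theta>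
      by (simp add: complex_norm_square [symmetric] nw)
    then show ?thesis using N T by (simp add: c_def)
  qed
  have c0: "c m = 0" if m: "m \<in> F" "m \<noteq> k" for m
  proof -
    obtain i where i: "e m i \<noteq> e k i" using m e by (metis ext injD)
    have "(\<Sum>\<theta>\<in>T. w \<theta> m * cnj (w \<theta> k)) = (\<Prod>i\<in>UNIV. \<Sum>t<N. (\<zeta> ^ t) ^ e m i * cnj (\<zeta> ^ t) ^ e k i)"
      by (simp add: prod_sum_PiE T_def w_def prod.distrib)
    also have "\<dots> = 0"
      using sum_roots_of_unity_character[of "e m i" N "e k i"] lt m i
      by (intro prod_zero) (auto simp: \<zeta>_def intro!: exI[of _ i])
    finally show ?thesis by (simp add: c_def)
  qed
  have avg: "(\<Sum>\<^sub>\<infinity>m. h m * c m) = (\<Sum>\<theta>\<in>T. cnj (w \<theta> k) * (\<Sum>\<^sub>\<infinity>m. h m * w \<theta> m)) / N ^ CARD('i)"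
  proof -
    have "(\<Sum>\<theta>\<in>T. cnj (w \<theta> k) * (\<Sum>\<^sub>\<infinity>m. h m * w \<theta> m)) =
        (\<Sum>\<theta>\<in>T. \<Sum>\<^sub>\<infinity>m. cnj (w \<theta> k) * (h m * w \<theta> m))"
      by (intro sum.cong refl infsum_cmult_right [symmetric] hs) (simp add: nw)
    also have "\<dots> = (\<Sum>\<^sub>\<infinity>m. \<Sum>\<theta>\<in>T. cnj (w \<theta> k) * (h m * w \<theta> m))"
      by (intro infsumI [symmetric] has_sum_sum has_sum_infsum summable_on_cmult_right hs) (simp add: nw)
    also have "\<dots> / N ^ CARD('i) = (\<Sum>\<^sub>\<infinity>m. (\<Sum>\<theta>\<in>T. cnj (w \<theta> k) * (h m * w \<theta> m)) / N ^ CARD('i))"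
      by (simp add: divide_inverse infsum_cmult_left')
    also have "\<dots> = (\<Sum>\<^sub>\<infinity>m. h m * c m)"
      by (intro infsum_cong) (simp add: c_def sum_distrib_left mult_ac)
    finally show ?thesis by simp
  qed
  have "cmod (\<Sum>\<^sub>\<infinity>m. h m * w \<theta> m) \<le> S" for \<theta>
  proof -
    have "h m * w \<theta> m = H m * (\<Prod>i\<in>UNIV. (of_real r * \<zeta> ^ \<theta> i) ^ e m i)" for m
      by (simp add: h_def w_def power_mult_distrib prod.distrib power_sum)
    then show ?thesis using bound[of "\<lambda>i. of_real r * \<zeta> ^ \<theta> i"] r by (simp add: norm_mult nz)
  qed
  then have "cmod (\<Sum>\<theta>\<in>T. cnj (w \<theta> k) * (\<Sum>\<^sub>\<infinity>m. h m * w \<theta> m)) \<le> (\<Sum>\<theta>\<in>T. S)"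
    by (intro sum_norm_le) (simp add: norm_mult nw)
  then have 1: "cmod (\<Sum>\<^sub>\<infinity>m. h m * c m) \<le> S"
    unfolding avg using N T by (simp add: norm_divide norm_power divide_simps mult.commute)
  have "(\<Sum>\<^sub>\<infinity>m. h m * c m) = h k * c k + (\<Sum>\<^sub>\<infinity>m\<in>-{k}. h m * c m)"
    using infsum_insert[of "\<lambda>m. h m * c m" "-{k}" k] summable_on_subset_banach[OF hs[OF c1], of "-{k}"]
    by (simp add: Compl_eq_Diff_UNIV insert_absorb)
  then have 2: "cmod (h k) \<le> S + cmod (\<Sum>\<^sub>\<infinity>m\<in>-{k}. h m * c m)"
    using 1 ck by (smt (verit) add_diff_cancel_right' mult.right_neutral norm_triangle_ineq4)
  \<comment> \<open>The members of F drop out by \<open>c0\<close>; what remains is part of the tail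
    of an absolutely convergent series beyond F, hence at most \<epsilon>.\<close>
  have "cmod (\<Sum>\<^sub>\<infinity>m\<in>-{k}. h m * c m) = cmod (\<Sum>\<^sub>\<infinity>m\<in>-F-{k}. h m * c m)"
    by (intro arg_cong[where f = cmod] infsum_cong_neutral) (use c0 in auto)
  also have "\<dots> \<le> (\<Sum>\<^sub>\<infinity>m\<in>-F-{k}. g m)"
    using summable_on_subset_banach[OF hs[OF c1], of "-F-{k}"] gs[of "-F-{k}"]
    by (intro norm_infsum_le[OF has_sum_infsum has_sum_infsum])
       (auto simp: norm_mult nh intro!: mult_left_le c1 g0)
  also have "\<dots> \<le> infsum g (-F)"
    by (intro infsum_mono2 gs) (auto simp: g0)
  also have "\<dots> = infsum g UNIV - sum g F"
    using infsum_Un_disjoint[of g F "-F"] F gs by (simp add: Compl_partition)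
  also have "\<dots> \<le> \<epsilon>" using F(2) by (simp add: dist_real_def)
  finally show "norm (H k) * r ^ (\<Sum>i\<in>UNIV. e k i) \<le> S + \<epsilon>"
    using 2 nh[of k] by (simp add: g_def)
qed

text \<open>
  The curve \<open>t \<mapsto> z0\<^sub>i exp (t v\<^sub>i)\<close> through two points with nonzero coordinates stays in the polydisc
  on a convex set of complex \<open>t\<close>, which reduces the claim to analytic continuation in one variable.
\<close>

lemma power_series_identity_multi:
  fixes e :: "'k \<Rightarrow> 'i::finite \<Rightarrow> nat" and H :: "'k \<Rightarrow> complex" and z0 :: "'i \<Rightarrow> complex"
  assumes e: "inj e" and R: "R > 0"
    and sm: "\<And>r. 0 \<le> r \<Longrightarrow> r < R \<Longrightarrow> (\<lambda>k. norm (H k) * r ^ (\<Sum>i\<in>UNIV. e k i)) summable_on UNIV"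
    and z0: "\<And>i. z0 i \<noteq> 0" "\<And>i. cmod (z0 i) < R"
    and "\<eta> > 0"
    and zero: "\<And>z. (\<And>i. cmod (z i - z0 i) < \<eta>) \<Longrightarrow> (\<Sum>\<^sub>\<infinity>k. H k * (\<Prod>i\<in>UNIV. z i ^ e k i)) = 0"
  shows "H k = 0"
proof -
  have vanish: "(\<Sum>\<^sub>\<infinity>k. H k * (\<Prod>i\<in>UNIV. z1 i ^ e k i)) = 0"
    if z1: "\<And>i. z1 i \<noteq> 0" "\<And>i. cmod (z1 i) < R" for z1
  proof -
    define v where "v i = Ln (z1 i) - Ln (z0 i)" for i
    define c where "c t i = exp (Ln (z0 i) + t * v i)" for t i
    define D where "D = {t. \<forall>i. cmod (c t i) < R}"
    define F where "F t = (\<Sum>\<^sub>\<infinity>k. H k * (\<Prod>i\<in>UNIV. c t i ^ e k i))" for t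
    have c01: "c 0 i = z0 i" "c 1 i = z1 i" for i
      using z0 z1 by (simp_all add: c_def v_def)
    have open_c: "open {t. \<forall>i. g (c t i) < b}" if "continuous_on UNIV g" for g :: "complex \<Rightarrow> real" and b
    proof -
      have "{t. \<forall>i. g (c t i) < b} = (\<Inter>i. {t. g (c t i) < b})" by auto
      moreover have "open {t. g (c t i) < b}" for i
        unfolding c_def
        by (intro open_Collect_less continuous_intros continuous_on_compose2[OF that]) auto
      ultimately show ?thesis by (simp add: open_INT)
    qed
    have oD: "open D" unfolding D_def by (rule open_c) (intro continuous_intros)
    \<comment> \<open>The modulus of \<open>c t i\<close> is the exponential of a real affine
      function of t, so each constraint cuts out an open half-plane.\<close>
    have "D = (\<Inter>i. {t. inner (cnj (v i)) t < ln R - Re (Ln (z0 i))})"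
    proof -
      have "exp x < R \<longleftrightarrow> x < ln R" for x using R by (metis exp_less_mono exp_less_cancel_iff exp_ln)
      then show ?thesis
        by (auto simp: D_def c_def inner_complex_def algebra_simps)
    qed
    then have cD: "connected D"
      by (auto intro!: convex_connected convex_INT convex_halfspace_lt)
    have hol: "F holomorphic_on D"
      unfolding holomorphic_on_def
    proof
      fix t0 assume t0: "t0 \<in> D"
      \<comment> \<open>A radius strictly between the largest coordinate of the curve at
        \<open>t0\<close> and R: near \<open>t0\<close> the curve stays below r, where the series
        has a fixed summable majorant.\<close>
      define r where "r = (Max (insert 0 (range (\<lambda>i. cmod (c t0 i)))) + R) / 2"
      have "Max (insert 0 (range (\<lambda>i. cmod (c t0 i)))) < R"
        using t0 R by (subst Max_less_iff) (auto simp: D_def)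
      moreover have "cmod (c t0 i) \<le> Max (insert 0 (range (\<lambda>i. cmod (c t0 i))))" for i
        by (rule Max_ge) auto
      moreover have "0 \<le> Max (insert 0 (range (\<lambda>i. cmod (c t0 i))))" by (rule Max_ge) auto
      ultimately have r: "0 \<le> r" "r < R" "\<And>i. cmod (c t0 i) < r"
        by (auto simp: r_def field_simps) (smt (verit))
      have "open {t. \<forall>i. cmod (c t i) < r}" by (rule open_c) (intro continuous_intros)
      moreover have "t0 \<in> {t. \<forall>i. cmod (c t i) < r}" using r by simp
      ultimately obtain d where d: "d > 0" "cball t0 d \<subseteq> {t. \<forall>i. cmod (c t i) < r}"
        using open_contains_cball by blast
      have ul: "uniform_limit (cball t0 d) (\<lambda>X t. \<Sum>k\<in>X. H k * (\<Prod>i\<in>UNIV. c t i ^ e k i)) F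
          (finite_subsets_at_top UNIV)"
        unfolding F_def
      proof (rule Weierstrass_m_test_general[OF _ sm[OF r(1,2)]])
        fix k t assume "t \<in> cball t0 d"
        then have "t \<in> {t. \<forall>i. cmod (c t i) < r}" using d(2) by blast
        then have "cmod (c t i) \<le> r" for i by (simp add: less_imp_le)
        then have "(\<Prod>i\<in>UNIV. cmod (c t i) ^ e k i) \<le> (\<Prod>i\<in>UNIV. r ^ e k i)"
          by (intro prod_mono conjI power_mono) auto
        then show "norm (H k * (\<Prod>i\<in>UNIV. c t i ^ e k i)) \<le> norm (H k) * r ^ (\<Sum>i\<in>UNIV. e k i)"
          by (simp add: norm_mult prod_norm [symmetric] norm_power power_sum mult_left_mono)
      qed
      have "F holomorphic_on ball t0 d"
        by (rule holomorphic_uniform_limit[OF _ ul])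
           (auto simp: c_def intro!: always_eventually holomorphic_intros continuous_intros)
      then show "F field_differentiable (at t0 within D)"
        using d by (meson centre_in_ball field_differentiable_at_within
            holomorphic_on_imp_differentiable_at open_ball)
    qed
    have "F 1 = 0"
    proof (rule analytic_continuation_open[OF _ oD _ cD _ hol])
      define s where "s = {t. \<forall>i. cmod (c t i - z0 i) < \<eta>}"
      have "s = (\<Inter>i. {t. cmod (c t i - z0 i) < \<eta>})" by (auto simp: s_def)
      moreover have "open {t. cmod (c t i - z0 i) < \<eta>}" for i
        unfolding c_def by (intro open_Collect_less continuous_intros)
      ultimately have "open s" by (simp add: open_INT)
      then show "open (s \<inter> D)" using oD by (rule open_Int)
      have "0 \<in> s \<inter> D" using z0 \<open>\<eta> > 0\<close> by (simp add: s_def D_def c01)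
      then show "s \<inter> D \<noteq> {}" by blast
      show "F t = 0" if "t \<in> s \<inter> D" for t
        unfolding F_def by (rule zero) (use that in \<open>auto simp: s_def\<close>)
      show "1 \<in> D" using z1 by (simp add: D_def c01)
    qed auto
    then show ?thesis by (simp add: F_def c01)
  qed
  \<comment> \<open>The torus of radius R / 2 consists of points with nonzero coordinates, all
    covered by \<open>vanish\<close>, so Cauchy's estimate applies with bound 0.\<close>
  have "norm (H k) * (R / 2) ^ (\<Sum>i\<in>UNIV. e k i) \<le> 0"
  proof (rule Cauchy_estimate_multi[OF e _ sm])
    fix z :: "'i \<Rightarrow> complex" assume z: "cmod (z i) = R / 2" for i
    have "z i \<noteq> 0" "cmod (z i) < R" for i using z[of i] R by auto
    then show "cmod (\<Sum>\<^sub>\<infinity>k. H k * (\<Prod>i\<in>UNIV. z i ^ e k i)) \<le> 0" using vanish[of z] by simp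
  qed (use R in auto)
  moreover have "(R / 2) ^ (\<Sum>i\<in>UNIV. e k i) > 0" using R by simp
  ultimately show ?thesis by (metis mult_le_0_iff norm_le_zero_iff not_less)
qed

section \<open>The flow on formal power series\<close>

lemma linear_ode_unique:
  fixes u :: "real \<Rightarrow> complex" and w :: complex
  assumes u: "\<And>s. s \<ge> 0 \<Longrightarrow> (u has_vector_derivative - w * u s) (at s within {0..})"
    and s: "s \<ge> 0"
  shows "u s = exp (- w * of_real s) * u 0"
proof -
  define v where "v s = exp (w * of_real s) * u s" for s
  have "(v has_vector_derivative 0) (at s within {0..})" if "s \<in> {0..}" for s
  proof -
    have "((\<lambda>s. exp (w * of_real s)) has_vector_derivative exp (w * of_real s) * w) (at s within {0..})"
      by (auto intro!: derivative_eq_intros has_vector_derivative_real_field)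
    from has_vector_derivative_mult[OF this u] that
    show ?thesis by (simp add: v_def[abs_def] algebra_simps)
  qed
  then obtain c where "\<And>s. s \<in> {0..} \<Longrightarrow> v s = c"
    using has_vector_derivative_zero_constant[of "{0..}" v] by (meson convex_real_interval(1))
  then have "v s = v 0" using s by simp
  then show ?thesis by (simp add: v_def exp_minus field_simps)
qed

text \<open>Variation of constants (Duhamel's formula) for u' = - w u + g with u(0) = u0.\<close>

definition linear_ode_solution :: "complex \<Rightarrow> complex \<Rightarrow> (real \<Rightarrow> complex) \<Rightarrow> real \<Rightarrow> complex" where
  "linear_ode_solution w u0 g s =
     exp (- w * of_real s) * (u0 + integral {0..s} (\<lambda>t. exp (w * of_real t) * g t))"

lemma linear_ode_solution_0 [simp]: "linear_ode_solution w u0 g 0 = u0"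
  by (simp add: linear_ode_solution_def)

lemma linear_ode_solution_deriv:
  assumes g: "continuous_on {0..} g" and s: "s \<ge> 0"
  shows "(linear_ode_solution w u0 g has_vector_derivative
          - w * linear_ode_solution w u0 g s + g s) (at s within {0..})"
proof -
  let ?f = "\<lambda>t. exp (w * of_real t) * g t" and ?E = "\<lambda>s. exp (- w * of_real s)"
  have "continuous_on {0..s + 1} ?f"
    by (intro continuous_intros continuous_on_subset[OF g]) auto
  then have "((\<lambda>s. integral {0..s} ?f) has_vector_derivative ?f s) (at s within {0..s + 1})"
    by (rule integral_has_vector_derivative) (use s in auto)
  \<comment> \<open>The integral is differentiated on a compact interval; ending it at s + 1 rather
    than s keeps the two one-sided neighbourhoods of s the same, also at s = 0.\<close>
  moreover have "at s within {0..s + 1} = at s within {0..}"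
    by (rule at_within_nhd[of _ "{..<s + 1}"]) auto
  ultimately have "((\<lambda>s. u0 + integral {0..s} ?f) has_vector_derivative ?f s) (at s within {0..})"
    by (auto intro!: derivative_eq_intros)
  moreover have "(?E has_vector_derivative ?E s * (- w)) (at s within {0..})"
    by (auto intro!: derivative_eq_intros has_vector_derivative_real_field)
  ultimately have deriv: "((\<lambda>s. ?E s * (u0 + integral {0..s} ?f)) has_vector_derivative
      ?E s * ?f s + ?E s * (- w) * (u0 + integral {0..s} ?f)) (at s within {0..})"
    by (rule has_vector_derivative_mult[rotated])
  have "?E s * ?f s = g s" by (simp add: mult.assoc [symmetric] flip: exp_add)
  then have eq: "?E s * ?f s + ?E s * (- w) * (u0 + integral {0..s} ?f) =
      - w * linear_ode_solution w u0 g s + g s"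
    by (simp add: linear_ode_solution_def mult_ac)
  show ?thesis
    using deriv unfolding eq by (simp only: linear_ode_solution_def[abs_def])
qed

section \<open>Coefficients and degrees in the Poisson bracket\<close>

definition midx_kappa :: "'n \<Rightarrow> 'n::finite midx" where
  "midx_kappa j = (axis j 1, axis j 1)"

lemma midx_deg_add [simp]: "midx_deg (k + l) = midx_deg k + midx_deg l"
  by (simp add: midx_deg_def sum.distrib)

lemma midx_deg_kappa [simp]: "midx_deg (midx_kappa j) = 2"
  by (simp add: midx_deg_def midx_kappa_def axis_def)

lemma midx_diff_add [simp]: "midx_diff (k + l) = midx_diff k + midx_diff l"
  by (simp add: midx_diff_def vec_eq_iff)

lemma midx_diff_kappa [simp]: "midx_diff (midx_kappa j) = 0"
  by (simp add: midx_diff_def midx_kappa_def vec_eq_iff)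

lemma rvec_add [simp]: "rvec (p + q) = rvec p + rvec q"
  by (simp add: rvec_def vec_eq_iff)

lemma rvec_0 [simp]: "rvec 0 = 0"
  by (simp add: rvec_def vec_eq_iff)

lemma F_diamondD: "H \<in> F_diamond \<Longrightarrow> midx_deg k < 3 \<Longrightarrow> H k = 0"
  unfolding F_diamond_def by blast

lemma F_diamondI: "(\<And>k. midx_deg k < 3 \<Longrightarrow> H k = 0) \<Longrightarrow> H \<in> F_diamond"
  unfolding F_diamond_def by blast

text \<open>Subtraction of natural numbers truncates, so removing a unit vector can be undone only
  where the exponent is positive.\<close>

lemma axis_shift:
  fixes u v k :: "nat ^ 'n"
  assumes "v $ j > 0" "u + v = k + axis j 1"
  shows "u + (v - axis j 1) = k" "v - axis j 1 + u = k" "v - axis j 1 + axis j 1 = v"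
proof -
  show v: "v - axis j 1 + axis j 1 = v"
    using assms(1) by (auto simp: vec_eq_iff axis_def)
  then have "u + (v - axis j 1) + axis j 1 = k + axis j 1"
    using assms(2) by (simp add: add.assoc)
  then show "u + (v - axis j 1) = k" by simp
  then show "v - axis j 1 + u = k" by (simp add: add.commute)
qed

text \<open>Indexing by the exponents before differentiation puts both products of the bracket over
  the same splittings of k + \<kappa>_j, so they merge into one sum. The splittings that no pair of
  derivatives reaches have a zero exponent and thus a zero factor.\<close>

lemma pbracket_coeff:
  "pbracket F G k = \<i> * (\<Sum>j\<in>UNIV. \<Sum>(m, p) | m + p = k + midx_kappa j.
     (of_nat (snd m $ j * fst p $ j) - of_nat (fst m $ j * snd p $ j)) * F m * G p)"
proof -
  have fin: "finite {(m, p). m + p = k + midx_kappa j \<and> P m p}" for j P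
    by (rule finite_subset[OF _ finite_midx_splittings[of "k + midx_kappa j"]]) auto
  have 1: "series_mult (d_zbar j F) (d_z j G) k =
      (\<Sum>(m, p) | m + p = k + midx_kappa j. of_nat (snd m $ j * fst p $ j) * F m * G p)" for j
    unfolding series_mult_def d_zbar_def d_z_def
  proof (rule sum.reindex_bij_witness_not_neutral[where S' = "{}"
          and T' = "{(m, p). m + p = k + midx_kappa j \<and> (snd m $ j = 0 \<or> fst p $ j = 0)}"
          and j = "\<lambda>(l, m). (l + (0, axis j 1), m + (axis j 1, 0))"
          and i = "\<lambda>(m, p). (m - (0, axis j 1), p - (axis j 1, 0))"])
    fix x assume x: "x \<in> {(m, p). m + p = k + midx_kappa j} -
      {(m, p). m + p = k + midx_kappa j \<and> (snd m $ j = 0 \<or> fst p $ j = 0)}"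
    obtain a b c d where abcd: "x = ((a, b), (c, d))" by (metis surj_pair)
    have "c $ j > 0" "a + c = fst k + axis j 1" "b $ j > 0" "d + b = snd k + axis j 1"
      using x by (auto simp: abcd midx_kappa_def prod_eq_iff add.commute)
    note * = axis_shift[OF this(1,2)] axis_shift[OF this(3,4)]
    then show "(case case x of (m, p) \<Rightarrow> (m - (0, axis j 1), p - (axis j 1, 0)) of
        (l, m) \<Rightarrow> (l + (0, axis j 1), m + (axis j 1, 0))) = x"
      and "(case x of (m, p) \<Rightarrow> (m - (0, axis j 1), p - (axis j 1, 0))) \<in> {(l, m). l + m = k} - {}"
      by (auto simp: abcd prod_eq_iff)
  next
    fix x assume x: "x \<in> {(l, m). l + m = k} - {}"
    obtain a b c d where abcd: "x = ((a, b), (c, d))" by (metis surj_pair)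
    have k: "k = (a + c, b + d)" using x by (auto simp: abcd)
    show "(case x of (l, m) \<Rightarrow> (l + (0, axis j 1), m + (axis j 1, 0))) \<in> {(m, p). m + p = k + midx_kappa j} -
        {(m, p). m + p = k + midx_kappa j \<and> (snd m $ j = 0 \<or> fst p $ j = 0)}"
      by (simp add: abcd k midx_kappa_def add_ac)
  qed (auto simp: fin finite_midx_splittings)
  have 2: "series_mult (d_z j F) (d_zbar j G) k =
      (\<Sum>(m, p) | m + p = k + midx_kappa j. of_nat (fst m $ j * snd p $ j) * F m * G p)" for j
    unfolding series_mult_def d_zbar_def d_z_def
  proof (rule sum.reindex_bij_witness_not_neutral[where S' = "{}"
          and T' = "{(m, p). m + p = k + midx_kappa j \<and> (fst m $ j = 0 \<or> snd p $ j = 0)}"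
          and j = "\<lambda>(l, m). (l + (axis j 1, 0), m + (0, axis j 1))"
          and i = "\<lambda>(m, p). (m - (axis j 1, 0), p - (0, axis j 1))"])
    fix x assume x: "x \<in> {(m, p). m + p = k + midx_kappa j} -
      {(m, p). m + p = k + midx_kappa j \<and> (fst m $ j = 0 \<or> snd p $ j = 0)}"
    obtain a b c d where abcd: "x = ((a, b), (c, d))" by (metis surj_pair)
    have "a $ j > 0" "c + a = fst k + axis j 1" "d $ j > 0" "b + d = snd k + axis j 1"
      using x by (auto simp: abcd midx_kappa_def prod_eq_iff add.commute)
    note * = axis_shift[OF this(1,2)] axis_shift[OF this(3,4)]
    then show "(case case x of (m, p) \<Rightarrow> (m - (axis j 1, 0), p - (0, axis j 1)) of
        (l, m) \<Rightarrow> (l + (axis j 1, 0), m + (0, axis j 1))) = x"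
      and "(case x of (m, p) \<Rightarrow> (m - (axis j 1, 0), p - (0, axis j 1))) \<in> {(l, m). l + m = k} - {}"
      by (auto simp: abcd prod_eq_iff)
  next
    fix x assume x: "x \<in> {(l, m). l + m = k} - {}"
    obtain a b c d where abcd: "x = ((a, b), (c, d))" by (metis surj_pair)
    have k: "k = (a + c, b + d)" using x by (auto simp: abcd)
    show "(case x of (l, m) \<Rightarrow> (l + (axis j 1, 0), m + (0, axis j 1))) \<in> {(m, p). m + p = k + midx_kappa j} -
        {(m, p). m + p = k + midx_kappa j \<and> (fst m $ j = 0 \<or> snd p $ j = 0)}"
      by (simp add: abcd k midx_kappa_def add_ac)
  qed (auto simp: fin finite_midx_splittings)
  show ?thesis
    unfolding pbracket_def 1 2 by (simp add: sum_subtractf [symmetric] case_prod_unfold algebra_simps)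
qed

lemma pbracket_add_right: "pbracket F (\<lambda>l. G l + G' l) k = pbracket F G k + pbracket F G' k"
  unfolding pbracket_coeff
  by (simp add: distrib_left sum.distrib case_prod_unfold)

text \<open>The degrees of m and p add up to the degree of k plus 2. As both are at least 3 in
  nonzero terms, both are smaller than the degree of k: the coefficient system is
  triangular.\<close>

lemma pbracket_diamond_cong:
  assumes "F \<in> F_diamond" "F' \<in> F_diamond" "G \<in> F_diamond" "G' \<in> F_diamond"
    and eq: "\<And>l. midx_deg l < midx_deg k \<Longrightarrow> F l = F' l \<and> G l = G' l"
  shows "pbracket F G k = pbracket F' G' k"
proof -
  have "F m * G p = F' m * G' p" if "m + p = k + midx_kappa j" for m p j
  proof -
    have deg: "midx_deg m + midx_deg p = midx_deg k + 2"
      using arg_cong[OF that, of midx_deg] by simp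
    consider "midx_deg m < 3" | "midx_deg p < 3" | "midx_deg m < midx_deg k" "midx_deg p < midx_deg k"
      using deg by linarith
    then show ?thesis
      using assms(1-4)[THEN F_diamondD] eq by cases auto
  qed
  then show ?thesis
    unfolding pbracket_coeff
    by (intro arg_cong[where f = "(*) \<i>"] sum.cong refl) (auto simp: mult.assoc)
qed

text \<open>Monomials are eigenvectors of the bracket with \<open>H_two\<close>, since only the
  splittings with p = \<kappa>_j meet its support.\<close>

lemma pbracket_H_two: "pbracket F (H_two \<omega>) k = \<i> * of_real (\<omega> \<bullet> rvec (midx_diff k)) * F k"
proof -
  have "(\<Sum>(m, p) | m + p = k + midx_kappa j.
      (of_nat (snd m $ j * fst p $ j) - of_nat (fst m $ j * snd p $ j)) * F m * H_two \<omega> p)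
    = of_real (\<omega> $ j * rvec (midx_diff k) $ j) * F k" (is "sum ?f ?S = _") for j
  proof -
    have H: "H_two \<omega> p * of_nat (fst p $ j) = (if p = midx_kappa j then of_real (\<omega> $ j) else 0)"
      "H_two \<omega> p * of_nat (snd p $ j) = (if p = midx_kappa j then of_real (\<omega> $ j) else 0)" for p
    proof -
      have *: "(\<Sum>i\<in>UNIV. complex_of_real (\<omega> $ i) * (if p = midx_kappa i then 1 else 0)) * of_nat n
          = (if p = midx_kappa j then of_real (\<omega> $ j) else 0)"
        if "\<And>i. p = midx_kappa i \<Longrightarrow> n = (if i = j then 1 else 0)" for n
      proof (cases "\<exists>i. p = midx_kappa i")
        case True
        then obtain i where i: "p = midx_kappa i" by blast
        have inj: "midx_kappa i = midx_kappa i' \<longleftrightarrow> i = i'" for i' :: 'a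
          by (auto simp: midx_kappa_def axis_eq_axis)
        show ?thesis using that[OF i] by (auto simp: i inj if_distrib sum.delta' cong: if_cong)
      qed auto
      show "H_two \<omega> p * of_nat (fst p $ j) = (if p = midx_kappa j then of_real (\<omega> $ j) else 0)"
        "H_two \<omega> p * of_nat (snd p $ j) = (if p = midx_kappa j then of_real (\<omega> $ j) else 0)"
        using *[of "fst p $ j"] *[of "snd p $ j"]
        by (simp_all add: H_two_def kappa_def midx_kappa_def axis_def)
    qed
    have "sum ?f ?S = sum ?f {(k, midx_kappa j)}"
    proof (rule sum.mono_neutral_right)
      show "\<forall>x\<in>?S - {(k, midx_kappa j)}. ?f x = 0"
      proof
        fix x assume x: "x \<in> ?S - {(k, midx_kappa j)}"
        obtain m p where mp: "x = (m, p)" by (cases x)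
        then have "p \<noteq> midx_kappa j" using x by auto
        then have "H_two \<omega> p * of_nat (fst p $ j) = 0" "H_two \<omega> p * of_nat (snd p $ j) = 0"
          by (simp_all only: H if_False)
        then show "?f x = 0" by (auto simp: mp)
      qed
    qed (auto simp: finite_midx_splittings)
    also have "\<dots> = (of_nat (snd k $ j) * (H_two \<omega> (midx_kappa j) * of_nat (fst (midx_kappa j) $ j)) -
        of_nat (fst k $ j) * (H_two \<omega> (midx_kappa j) * of_nat (snd (midx_kappa j) $ j))) * F k"
      by (simp add: algebra_simps)
    also have "\<dots> = of_real (\<omega> $ j * rvec (midx_diff k) $ j) * F k"
      by (simp only: H) (simp add: rvec_def midx_diff_def algebra_simps)
    finally show ?thesis .
  qed
  then show ?thesis
    unfolding pbracket_coeff by (simp add: inner_vec_def sum_distrib_right)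
qed

text \<open>The factor - i \<sigma> in \<open>xi\<close> turns the imaginary eigenvalue of the
  quadratic part into a real damping rate, its absolute value. The rest of the bracket involves only
  lower degrees.\<close>

lemma flow_rhs:
  "- pbracket (xi \<omega> H) (\<lambda>l. H_two \<omega> l + H l) k =
     - of_real \<bar>\<omega> \<bullet> rvec (midx_diff k)\<bar> * H k + - pbracket (xi \<omega> H) H k"
proof -
  define a where "a = \<omega> \<bullet> rvec (midx_diff k)"
  have "\<i> * of_real a * xi \<omega> H k = of_real (sgn a * a) * H k"
    by (simp add: xi_def a_def algebra_simps)
  also have "sgn a * a = \<bar>a\<bar>" by (simp add: abs_sgn mult.commute)
  finally show ?thesis
    by (simp add: pbracket_add_right pbracket_H_two a_def)
qed

section \<open>Existence and uniqueness by recursion on the degree\<close>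

lemma xi_diamond: "H \<in> F_diamond \<Longrightarrow> xi \<omega> H \<in> F_diamond"
  by (auto intro!: F_diamondI simp: xi_def dest: F_diamondD)

lemma continuous_on_pbracket:
  assumes "\<And>l. continuous_on S (\<lambda>s. F s l)" "\<And>l. continuous_on S (\<lambda>s. G s l)"
  shows "continuous_on S (\<lambda>s. pbracket (F s) (G s) k)"
  unfolding pbracket_coeff case_prod_unfold by (intro continuous_intros assms)

text \<open>Each coefficient solves a scalar equation forced by those of lower degree. The
  truncation by \<open>if\<close> makes the recursion visibly well-founded; by
  \<open>pbracket_diamond_cong\<close> it leaves the bracket at k unchanged.\<close>

function flow_coeff :: "real ^ 'n \<Rightarrow> 'n::finite series \<Rightarrow> 'n midx \<Rightarrow> real \<Rightarrow> complex" where
  "flow_coeff \<omega> H0 k = linear_ode_solution (of_real \<bar>\<omega> \<bullet> rvec (midx_diff k)\<bar>) (H0 k)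
     (\<lambda>s. - pbracket (xi \<omega> (\<lambda>l. if midx_deg l < midx_deg k then flow_coeff \<omega> H0 l s else 0))
                     (\<lambda>l. if midx_deg l < midx_deg k then flow_coeff \<omega> H0 l s else 0) k)"
  by pat_completeness auto
termination by (relation "Wellfounded.measure (\<lambda>(\<omega>, H0, k). midx_deg k)") auto

declare flow_coeff.simps [simp del]

lemma flow_coeff_diamond:
  assumes "H0 \<in> F_diamond" "midx_deg k < 3"
  shows "flow_coeff \<omega> H0 k s = 0"
  using assms(2)
proof (induction "midx_deg k" arbitrary: k s rule: less_induct)
  case less
  have "(if midx_deg l < midx_deg k then flow_coeff \<omega> H0 l s else 0) = 0" for l s
    using less by simp
  then show ?case
    using F_diamondD[OF assms(1) less.prems]
    by (simp add: flow_coeff.simps[of \<omega> H0 k] xi_def pbracket_coeff linear_ode_solution_def)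
qed

lemma flow_solution_flow_coeff:
  assumes H0: "H0 \<in> F_diamond"
  shows "flow_solution \<omega> H0 (\<lambda>s k. flow_coeff \<omega> H0 k s)"
proof -
  have dia: "(\<lambda>k. flow_coeff \<omega> H0 k s) \<in> F_diamond" for s
    by (intro F_diamondI flow_coeff_diamond[OF H0])
  have deriv: "(flow_coeff \<omega> H0 k has_vector_derivative
      - pbracket (xi \<omega> (\<lambda>k. flow_coeff \<omega> H0 k s)) (\<lambda>l. H_two \<omega> l + flow_coeff \<omega> H0 l s) k)
      (at s within {0..})" if "s \<ge> 0" for k s
    using that
  proof (induction "midx_deg k" arbitrary: k s rule: less_induct)
    case less
    define G where "G s l = (if midx_deg l < midx_deg k then flow_coeff \<omega> H0 l s else 0)" for s l
    have G: "G s \<in> F_diamond" for s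
      by (intro F_diamondI) (simp add: flow_coeff_diamond[OF H0] G_def)
    have cG: "continuous_on {0..} (\<lambda>s. G s l)" for l
      using less(1)[of l] unfolding G_def
      by (cases "midx_deg l < midx_deg k")
         (auto intro!: has_vector_derivative_continuous simp: continuous_on_eq_continuous_within)
    have cx: "continuous_on {0..} (\<lambda>s. xi \<omega> (G s) l)" for l
      unfolding xi_def by (intro continuous_intros cG)
    have "flow_coeff \<omega> H0 k = linear_ode_solution (of_real \<bar>\<omega> \<bullet> rvec (midx_diff k)\<bar>) (H0 k)
        (\<lambda>s. - pbracket (xi \<omega> (G s)) (G s) k)"
      unfolding flow_coeff.simps[of \<omega> H0 k] G_def ..
    moreover have "continuous_on {0..} (\<lambda>s. - pbracket (xi \<omega> (G s)) (G s) k)"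
      by (intro continuous_intros continuous_on_pbracket cG cx)
    ultimately have "(flow_coeff \<omega> H0 k has_vector_derivative
        - of_real \<bar>\<omega> \<bullet> rvec (midx_diff k)\<bar> * flow_coeff \<omega> H0 k s + - pbracket (xi \<omega> (G s)) (G s) k)
        (at s within {0..})"
      using linear_ode_solution_deriv less.prems by (metis (no_types, lifting))
    moreover have "pbracket (xi \<omega> (G s)) (G s) k =
        pbracket (xi \<omega> (\<lambda>k. flow_coeff \<omega> H0 k s)) (\<lambda>k. flow_coeff \<omega> H0 k s) k"
      by (intro pbracket_diamond_cong xi_diamond G dia) (simp add: G_def xi_def)
    ultimately show ?case by (simp only: flow_rhs)
  qed
  show ?thesis
    unfolding flow_solution_def
  proof (intro conjI allI impI)
    show "(\<lambda>k. flow_coeff \<omega> H0 k 0) = H0"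
      by (rule ext, subst flow_coeff.simps) simp
  qed (use dia deriv in auto)
qed

lemma flow_solution_deriv:
  assumes "flow_solution \<omega> H0 H" "s \<ge> 0"
  shows "((\<lambda>s. H s k) has_vector_derivative
     - of_real \<bar>\<omega> \<bullet> rvec (midx_diff k)\<bar> * H s k + - pbracket (xi \<omega> (H s)) (H s) k) (at s within {0..})"
  using assms unfolding flow_solution_def flow_rhs by blast

text \<open>By induction on the degree the forcing terms of two solutions agree, so their difference
  at k solves a homogeneous equation with initial value 0.\<close>

lemma flow_solution_unique:
  assumes H: "flow_solution \<omega> H0 H" and H': "flow_solution \<omega> H0 H'" and s: "s \<ge> 0"
  shows "H s = H' s"
proof
  fix k
  show "H s k = H' s k" using s
  proof (induction "midx_deg k" arbitrary: k s rule: less_induct)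
    case less
    define a where "a = complex_of_real \<bar>\<omega> \<bullet> rvec (midx_diff k)\<bar>"
    have "H s k - H' s k = exp (- a * of_real s) * (H 0 k - H' 0 k)"
    proof (rule linear_ode_unique[OF _ less.prems])
      fix s :: real assume s: "s \<ge> 0"
      have "H s \<in> F_diamond" "H' s \<in> F_diamond"
        using H H' s by (simp_all add: flow_solution_def)
      then have "pbracket (xi \<omega> (H s)) (H s) k = pbracket (xi \<omega> (H' s)) (H' s) k"
        by (intro pbracket_diamond_cong xi_diamond) (auto simp: xi_def less.hyps s)
      then show "((\<lambda>s. H s k - H' s k) has_vector_derivative - a * (H s k - H' s k)) (at s within {0..})"
        using has_vector_derivative_diff[OF flow_solution_deriv[OF H s, of k] flow_solution_deriv[OF H' s, of k]]
        by (simp add: a_def algebra_simps)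
    qed
    moreover have "H 0 = H' 0" using H H' by (simp add: flow_solution_def)
    ultimately show ?case by simp
  qed
qed

lemma phi_eqI:
  assumes "flow_solution \<omega> H0 H" "\<delta> \<ge> 0"
  shows "phi \<omega> \<delta> H0 = H \<delta>"
  unfolding phi_def by (rule the_equality) (use assms flow_solution_unique in blast)+

section \<open>Initial values supported in a half-space\<close>

lemma fst_midx_kappa_same [simp]: "fst (midx_kappa j) $ j = 1"
  by (simp add: midx_kappa_def)

lemma midx_diff_0 [simp]: "midx_diff 0 = 0"
  by (simp add: midx_diff_def vec_eq_iff)

lemma series_eq_0_of_support:
  assumes "series_support H \<subseteq> X" "midx_diff k \<notin> X"
  shows "H k = 0"
proof (rule ccontr)
  assume "H k \<noteq> 0"
  then have "series_part (midx_diff k) H k \<noteq> 0" by (simp add: series_part_def)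
  then have "midx_diff k \<in> series_support H" by (auto simp: series_support_def)
  then show False using assms by blast
qed

lemma pbracket_diamond_degree:
  assumes "F \<in> F_diamond" "G \<in> F_diamond" "m + p = k + midx_kappa j" "F m * G p \<noteq> 0"
  shows "midx_deg m < midx_deg k" "midx_deg p < midx_deg k"
proof -
  have "midx_deg m + midx_deg p = midx_deg k + 2"
    using arg_cong[OF assms(3), of midx_deg] by simp
  moreover have "midx_deg m \<ge> 3" "midx_deg p \<ge> 3"
    using assms(4) by (metis F_diamondD assms(1,2) mult_eq_0_iff not_less)+
  ultimately show "midx_deg m < midx_deg k" "midx_deg p < midx_deg k" by linarith+
qed

lemma inner_rvec_splitting:
  assumes "m + p = k + midx_kappa j"
  shows "\<omega> \<bullet> rvec (midx_diff m) + \<omega> \<bullet> rvec (midx_diff p) = \<omega> \<bullet> rvec (midx_diff k)"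
  using arg_cong[OF assms, of "\<lambda>k. \<omega> \<bullet> rvec (midx_diff k)"] by (simp add: inner_add_right)

text \<open>Frequencies add up along splittings, so a negative total needs a negative factor, which
  has lower degree and vanishes by induction. The half-space is therefore invariant.\<close>

lemma flow_solution_support:
  assumes H: "flow_solution \<omega> H0 H" and supp: "series_support H0 \<subseteq> {q. \<omega> \<bullet> rvec q \<ge> 0}"
    and "s \<ge> 0" "\<omega> \<bullet> rvec (midx_diff k) < 0"
  shows "H s k = 0"
  using assms(3,4)
proof (induction "midx_deg k" arbitrary: k s rule: less_induct)
  case less
  define a where "a = complex_of_real \<bar>\<omega> \<bullet> rvec (midx_diff k)\<bar>"
  have "H s k = exp (- a * of_real s) * H 0 k"
  proof (rule linear_ode_unique[OF _ less.prems(1)])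
    fix s :: real assume s: "s \<ge> 0"
    have dia: "H s \<in> F_diamond" using H s by (simp add: flow_solution_def)
    have "H s m * H s p = 0" if mp: "m + p = k + midx_kappa j" for m p j
    proof (rule ccontr)
      assume nz: "H s m * H s p \<noteq> 0"
      have "\<omega> \<bullet> rvec (midx_diff m) < 0 \<or> \<omega> \<bullet> rvec (midx_diff p) < 0"
        using inner_rvec_splitting[OF mp, of \<omega>] less.prems(2) by linarith
      then show False
        using less.hyps pbracket_diamond_degree[OF dia dia mp nz] s nz by (metis mult_eq_0_iff)
    qed
    then have "pbracket (xi \<omega> (H s)) (H s) k = 0"
      unfolding pbracket_coeff xi_def by (auto intro!: sum.neutral)
    then show "((\<lambda>s. H s k) has_vector_derivative - a * H s k) (at s within {0..})"
      using flow_solution_deriv[OF H s, of k] by (simp add: a_def)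
  qed
  moreover have "H 0 k = 0"
    using series_eq_0_of_support[OF supp, of k] H less.prems(2) by (simp add: flow_solution_def)
  ultimately show ?case by simp
qed

section \<open>The linear equation for a single part \<open>H^q\<close>\<close>

definition kappa_deriv :: "'n \<Rightarrow> 'n::finite series \<Rightarrow> 'n series" where
  "kappa_deriv j F = (\<lambda>l. of_nat (fst l $ j + 1) * F (l + midx_kappa j))"

text \<open>The multiplier a of the overview as a formal series, for F a series in \<kappa>. For
  such F the exponents of \<open>z_j\<close> and of its bar agree, so \<open>kappa_deriv\<close>,
  which reads off the former, is the derivative with respect to \<kappa>_j.\<close>

definition flow_symbol :: "real ^ 'n \<Rightarrow> int ^ 'n \<Rightarrow> 'n::finite series \<Rightarrow> 'n series" where
  "flow_symbol \<omega> q F = (\<lambda>l. (if l = 0 then of_real (\<omega> \<bullet> rvec q) else 0) +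
     (\<Sum>j\<in>UNIV. of_int (q $ j) * kappa_deriv j F l))"

lemma sum_splittings_antisym:
  fixes f :: "'n::finite midx \<Rightarrow> 'n midx \<Rightarrow> complex"
  assumes "\<And>m p. f p m = - f m p"
  shows "(\<Sum>(m, p) | m + p = k. f m p) = 0"
proof -
  have "(\<Sum>(m, p) | m + p = k. f m p) = (\<Sum>(m, p) | m + p = k. f p m)"
    by (rule sum.reindex_bij_witness[where i = prod.swap and j = prod.swap]) (auto simp: add.commute)
  also have "\<dots> = (\<Sum>(m, p) | m + p = k. - f m p)"
    unfolding case_prod_unfold by (intro sum.cong refl assms)
  finally show ?thesis by (simp add: case_prod_unfold sum_negf)
qed

lemma series_mult_delta:
  fixes G :: "'n::finite series"
  shows "series_mult (\<lambda>l. if l = 0 then c else 0) G k = c * G k"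
proof -
  have "series_mult (\<lambda>l. if l = 0 then c else 0) G k =
      (\<Sum>(l, m)\<in>{(0 :: 'n midx, k)}. (if l = 0 then c else 0) * G m)"
    unfolding series_mult_def
    by (rule sum.mono_neutral_right) (auto simp: finite_midx_splittings zero_prod_def split: if_splits)
  then show ?thesis by simp
qed

lemma series_mult_add_left: "series_mult (\<lambda>l. F l + F' l) G k = series_mult F G k + series_mult F' G k"
  by (simp add: series_mult_def case_prod_unfold distrib_right sum.distrib)

lemma series_mult_sum_left: "series_mult (\<lambda>l. \<Sum>j\<in>A. F j l) G k = (\<Sum>j\<in>A. series_mult (F j) G k)"
  unfolding series_mult_def case_prod_unfold sum_distrib_right by (rule sum.swap)

lemma series_mult_scale_left: "series_mult (\<lambda>l. c * F l) G k = c * series_mult F G k"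
  by (simp add: series_mult_def case_prod_unfold sum_distrib_left mult.assoc)

text \<open>In the part with p' = 0, a positive exponent of \<open>z_j\<close> forces a positive
  exponent of its bar, so \<kappa>_j can genuinely be split off from p. Splittings where the
  exponent is 0 carry a zero factor.\<close>

lemma sum_splittings_kappa_deriv:
  "(\<Sum>(m, p) | m + p = k + midx_kappa j. of_nat (fst p $ j) * series_part 0 F p * G m) =
    series_mult (kappa_deriv j (series_part 0 F)) G k"
  unfolding series_mult_def
proof (rule sum.reindex_bij_witness_not_neutral[symmetric, where S' = "{(l, m). l + m = k \<and> series_part 0 F (l + midx_kappa j) = 0}"
      and T' = "{(m, p). m + p = k + midx_kappa j \<and> of_nat (fst p $ j) * series_part 0 F p = 0}"
      and j = "\<lambda>(l, m). (m, l + midx_kappa j)" and i = "\<lambda>(m, p). (p - midx_kappa j, m)"])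
  fix x assume x: "x \<in> {(m, p). m + p = k + midx_kappa j} -
    {(m, p). m + p = k + midx_kappa j \<and> of_nat (fst p $ j) * series_part 0 F p = 0}"
  obtain a b c d where abcd: "x = ((a, b), (c, d))" by (metis surj_pair)
  have "midx_diff (c, d) = 0" "c $ j > 0"
    using x by (auto simp: abcd series_part_def split: if_splits)
  then have "d $ j > 0" by (simp add: midx_diff_def vec_eq_iff)
  have "a + c = fst k + axis j 1" "b + d = snd k + axis j 1"
    using x by (auto simp: abcd midx_kappa_def prod_eq_iff add.commute)
  note * = axis_shift[OF \<open>c $ j > 0\<close> this(1)] axis_shift[OF \<open>d $ j > 0\<close> this(2)]
  show "(case case x of (m, p) \<Rightarrow> (p - midx_kappa j, m) of (l, m) \<Rightarrow> (m, l + midx_kappa j)) = x"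
    and "(case x of (m, p) \<Rightarrow> (p - midx_kappa j, m)) \<in> {(l, m). l + m = k} -
      {(l, m). l + m = k \<and> series_part 0 F (l + midx_kappa j) = 0}"
    using * x by (auto simp: abcd prod_eq_iff midx_kappa_def)
next
  show "finite {(l, m). l + m = k \<and> series_part 0 F (l + midx_kappa j) = 0}"
    by (rule finite_subset[OF _ finite_midx_splittings[of k]]) auto
  show "finite {(m, p). m + p = k + midx_kappa j \<and> of_nat (fst p $ j) * series_part 0 F p = 0}"
    by (rule finite_subset[OF _ finite_midx_splittings[of "k + midx_kappa j"]]) auto
next
  fix x :: "'a midx \<times> 'a midx"
  obtain l m where lm: "x = (l, m)" by (metis surj_pair)
  show "(case case x of (l, m) \<Rightarrow> (m, l + midx_kappa j) of (m, p) \<Rightarrow> (p - midx_kappa j, m)) = x"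
    by (simp add: lm)
  show "(case case x of (l, m) \<Rightarrow> (m, l + midx_kappa j) of
      (m, p) \<Rightarrow> of_nat (fst p $ j) * series_part 0 F p * G m) =
    (case x of (l, m) \<Rightarrow> kappa_deriv j (series_part 0 F) l * G m)"
    by (simp add: lm kappa_deriv_def)
  {
    assume "x \<in> {(l, m). l + m = k} - {(l, m). l + m = k \<and> series_part 0 F (l + midx_kappa j) = 0}"
    then have "k = l + m" "series_part 0 F (l + midx_kappa j) \<noteq> 0" by (auto simp: lm)
    then show "(case x of (l, m) \<Rightarrow> (m, l + midx_kappa j)) \<in> {(m, p). m + p = k + midx_kappa j} -
        {(m, p). m + p = k + midx_kappa j \<and> of_nat (fst p $ j) * series_part 0 F p = 0}"
      by (simp add: lm add_ac del: of_nat_Suc)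
  next
    assume "x \<in> {(l, m). l + m = k \<and> series_part 0 F (l + midx_kappa j) = 0}"
    then show "(case x of (l, m) \<Rightarrow> kappa_deriv j (series_part 0 F) l * G m) = 0"
      by (simp add: lm kappa_deriv_def)
  next
    assume "x \<in> {(m, p). m + p = k + midx_kappa j \<and> of_nat (fst p $ j) * series_part 0 F p = 0}"
    then show "(case x of (m, p) \<Rightarrow> of_nat (fst p $ j) * series_part 0 F p * G m) = 0"
      by (simp add: lm)
  }
qed

text \<open>Two nonnegative frequencies with sum 0 both vanish, and \<open>xi\<close> annihilates
  terms of frequency 0.\<close>

lemma pbracket_xi_eq_0:
  assumes supp: "\<And>m. H m \<noteq> 0 \<Longrightarrow> \<omega> \<bullet> rvec (midx_diff m) \<ge> 0" and k: "midx_diff k = 0"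
  shows "pbracket (xi \<omega> H) H k = 0"
proof -
  have "xi \<omega> H m * H p = 0" if mp: "m + p = k + midx_kappa j" for m p j
  proof (rule ccontr)
    assume nz: "xi \<omega> H m * H p \<noteq> 0"
    then have "\<omega> \<bullet> rvec (midx_diff m) \<ge> 0" "\<omega> \<bullet> rvec (midx_diff p) \<ge> 0"
      by (intro supp; auto simp: xi_def)+
    then have "\<omega> \<bullet> rvec (midx_diff m) = 0"
      using inner_rvec_splitting[OF mp, of \<omega>] k by simp
    then show False using nz by (simp add: xi_def)
  qed
  then show ?thesis
    unfolding pbracket_coeff by (auto intro!: sum.neutral simp: mult.assoc)
qed

text \<open>
  Among the products \<open>H m * H p\<close>, those with \<open>m'\<close> and \<open>p'\<close> both nonzero carry \<open>\<sigma> = 1\<close> and cancel by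
  antisymmetry of the bracket, so that only \<open>p' = 0\<close> remains.
\<close>

lemma pbracket_xi_pos:
  assumes nr: "nonresonant \<omega>"
    and supp: "\<And>m. H m \<noteq> 0 \<Longrightarrow> \<omega> \<bullet> rvec (midx_diff m) \<ge> 0" and k: "\<omega> \<bullet> rvec (midx_diff k) > 0"
  shows "pbracket (xi \<omega> H) H k =
    (\<Sum>j\<in>UNIV. of_int (midx_diff k $ j) * series_mult (kappa_deriv j (series_part 0 H)) H k)"
proof -
  define c where "c j m p = complex_of_nat (snd m $ j * fst p $ j) - of_nat (fst m $ j * snd p $ j)"
    for j :: 'a and m p :: "'a midx"
  define f where "f j m p = (if midx_diff m \<noteq> 0 \<and> midx_diff p \<noteq> 0 then c j m p * H m * H p else 0)" for j m p
  have "\<i> * (c j m p * xi \<omega> H m * H p) =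
      of_int (midx_diff k $ j) * (of_nat (fst p $ j) * series_part 0 H p * H m) + f j m p"
    if mp: "m + p = k + midx_kappa j" for j m p
  proof (cases "H m = 0 \<or> H p = 0")
    case True
    then show ?thesis by (auto simp: xi_def f_def series_part_def)
  next
    case False
    then have nn: "\<omega> \<bullet> rvec (midx_diff m) \<ge> 0" "\<omega> \<bullet> rvec (midx_diff p) \<ge> 0" using supp by auto
    have sum: "midx_diff m + midx_diff p = midx_diff k"
      using arg_cong[OF mp, of midx_diff] by simp
    have xi: "\<i> * (c j m p * xi \<omega> H m * H p) = of_real (sgn (\<omega> \<bullet> rvec (midx_diff m))) * (c j m p * H m * H p)"
      by (simp add: xi_def algebra_simps)
    show ?thesis
    proof (cases "midx_diff m = 0")
      case True
      then have "midx_diff p \<noteq> 0" using sum k by auto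
      then show ?thesis unfolding xi using True by (simp add: f_def series_part_def)
    next
      case m: False
      \<comment> \<open>The support gives a nonnegative frequency and nonresonance excludes 0 for m'
        \<noteq> 0.\<close>
      then have "sgn (\<omega> \<bullet> rvec (midx_diff m)) = 1"
        using nr nn unfolding nonresonant_def by (metis less_eq_real_def sgn_pos)
      moreover have "c j m p = of_int (midx_diff k $ j) * of_nat (fst p $ j)" if "midx_diff p = 0"
      proof -
        have p: "snd p $ j = fst p $ j"
          using that by (simp add: midx_diff_def vec_eq_iff)
        have "midx_diff k = midx_diff m" using that sum by simp
        then have "of_int (midx_diff k $ j) = complex_of_nat (snd m $ j) - of_nat (fst m $ j)"
          by (simp add: midx_diff_def)
        then show ?thesis by (simp add: c_def p left_diff_distrib)
      qed
      ultimately show ?thesis unfolding xi using m by (auto simp: f_def series_part_def)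
    qed
  qed
  then have "pbracket (xi \<omega> H) H k = (\<Sum>j\<in>UNIV. \<Sum>(m, p) | m + p = k + midx_kappa j.
      of_int (midx_diff k $ j) * (of_nat (fst p $ j) * series_part 0 H p * H m) + f j m p)"
    unfolding pbracket_coeff sum_distrib_left
    by (intro sum.cong refl) (auto simp: c_def)
  also have "\<dots> = (\<Sum>j\<in>UNIV. of_int (midx_diff k $ j) *
      (\<Sum>(m, p) | m + p = k + midx_kappa j. of_nat (fst p $ j) * series_part 0 H p * H m) +
      (\<Sum>(m, p) | m + p = k + midx_kappa j. f j m p))"
    by (simp add: case_prod_unfold sum.distrib sum_distrib_left)
  also have "\<dots> = (\<Sum>j\<in>UNIV. of_int (midx_diff k $ j) * series_mult (kappa_deriv j (series_part 0 H)) H k)"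
  proof -
    have "(\<Sum>(m, p) | m + p = k + midx_kappa j. f j m p) = 0" for j
      by (rule sum_splittings_antisym) (simp add: f_def c_def algebra_simps)
    then show ?thesis by (simp add: sum_splittings_kappa_deriv)
  qed
  finally show ?thesis .
qed

lemma series_mult_flow_symbol:
  "series_mult (flow_symbol \<omega> q F) G k = of_real (\<omega> \<bullet> rvec q) * G k +
     (\<Sum>j\<in>UNIV. of_int (q $ j) * series_mult (kappa_deriv j F) G k)"
  unfolding flow_symbol_def series_mult_add_left series_mult_delta series_mult_sum_left
    series_mult_scale_left ..

lemma flow_symbol_diff:
  assumes "flow_symbol \<omega> q (series_part 0 F) l \<noteq> 0"
  shows "midx_diff l = 0"
proof (rule ccontr)
  assume l: "midx_diff l \<noteq> 0"
  then have "kappa_deriv j (series_part 0 F) l = 0" for j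
    by (simp add: kappa_deriv_def series_part_def)
  moreover have "l \<noteq> 0" using l by auto
  ultimately show False using assms by (simp add: flow_symbol_def)
qed

text \<open>A factor supported on k' = 0 respects the grading by k', so multiplication by it
  commutes with the projection to each part.\<close>

lemma series_mult_series_part:
  assumes "\<And>l. F l \<noteq> 0 \<Longrightarrow> midx_diff l = 0"
  shows "series_mult F (series_part q G) k = series_part q (series_mult F G) k"
proof -
  have "F l * series_part q G m = (if midx_diff k = q then F l * G m else 0)" if "l + m = k" for l m
    using assms[of l] arg_cong[OF that, of midx_diff] by (cases "F l = 0") (auto simp: series_part_def)
  then show ?thesis
    unfolding series_mult_def series_part_def[of q "\<lambda>k. _ k"] by (auto intro!: sum.cong sum.neutral)
qed

text \<open>At k' = 0 both the damping rate and the bracket term are zero, so these coefficients are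
  constant in time.\<close>

lemma flow_solution_part_0:
  assumes H: "flow_solution \<omega> H0 H"
    and supp: "series_support H0 \<subseteq> {q. \<omega> \<bullet> rvec q \<ge> 0}" and s: "s \<ge> 0"
  shows "series_part 0 (H s) = series_part 0 H0"
proof
  fix k :: "'a midx"
  have "H s k = H0 k" if k: "midx_diff k = 0"
  proof -
    have "H s k = exp (- 0 * of_real s) * H 0 k"
    proof (rule linear_ode_unique[OF _ s])
      fix s :: real assume s: "s \<ge> 0"
      have "pbracket (xi \<omega> (H s)) (H s) k = 0"
        by (rule pbracket_xi_eq_0[OF _ k])
           (use flow_solution_support[OF H supp s] in \<open>force simp: not_less [symmetric]\<close>)
      then show "((\<lambda>s. H s k) has_vector_derivative - 0 * H s k) (at s within {0..})"
        using flow_solution_deriv[OF H s, of k] k by simp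
    qed
    then show ?thesis using H by (simp add: flow_solution_def)
  qed
  then show "series_part 0 (H s) k = series_part 0 H0 k" by (simp add: series_part_def)
qed

text \<open>As the part with q = 0 is conserved, the multiplier can be formed from the initial
  value; the equation for the q-part is thus linear with constant coefficients.\<close>

lemma flow_solution_part:
  assumes nr: "nonresonant \<omega>" and H: "flow_solution \<omega> H0 H"
    and supp: "series_support H0 \<subseteq> {q. \<omega> \<bullet> rvec q \<ge> 0}" and s: "s \<ge> 0" and q: "\<omega> \<bullet> rvec q > 0"
  shows "((\<lambda>s. series_part q (H s) k) has_vector_derivative
     - series_mult (flow_symbol \<omega> q (series_part 0 H0)) (series_part q (H s)) k) (at s within {0..})"
proof -
  have *: "series_mult (flow_symbol \<omega> q (series_part 0 H0)) (series_part q (H s)) k =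
     series_part q (series_mult (flow_symbol \<omega> q (series_part 0 H0)) (H s)) k"
    by (rule series_mult_series_part) (rule flow_symbol_diff)
  show ?thesis
  proof (cases "midx_diff k = q")
    case True
    have "pbracket (xi \<omega> (H s)) (H s) k =
        (\<Sum>j\<in>UNIV. of_int (midx_diff k $ j) * series_mult (kappa_deriv j (series_part 0 (H s))) (H s) k)"
      by (rule pbracket_xi_pos[OF nr])
         (use flow_solution_support[OF H supp s] q True in \<open>force simp: not_less [symmetric]\<close>)+
    then show ?thesis
      using flow_solution_deriv[OF H s, of k] True q
      unfolding * flow_solution_part_0[OF H supp s]
      by (simp add: series_part_def[of q] series_mult_flow_symbol)
  next
    case False
    then show ?thesis unfolding * by (simp add: series_part_def)
  qed
qed

section \<open>Summation of the coefficient equations\<close>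

text \<open>Flattening both groups of variables into the single index type \<open>'n + 'n\<close>
  makes the general lemmas on power series applicable.\<close>

definition midx_exponent :: "'n::finite midx \<Rightarrow> 'n + 'n \<Rightarrow> nat" where
  "midx_exponent k = case_sum (($) (fst k)) (($) (snd k))"

definition polydisc_point :: "('n::finite + 'n \<Rightarrow> complex) \<Rightarrow> (complex ^ 'n) \<times> (complex ^ 'n)" where
  "polydisc_point z = ((\<chi> j. z (Inl j)), (\<chi> j. z (Inr j)))"

lemma inj_midx_exponent: "inj midx_exponent"
proof (rule injI)
  fix k l :: "'n::finite midx" assume eq: "midx_exponent k = midx_exponent l"
  show "k = l"
    using fun_cong[OF eq, of "Inl _"] fun_cong[OF eq, of "Inr _"]
    by (simp add: midx_exponent_def prod_eq_iff vec_eq_iff)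
qed

lemma sum_midx_exponent: "(\<Sum>i\<in>UNIV. midx_exponent k i) = midx_deg k"
  by (subst UNIV_Plus_UNIV [symmetric], subst sum.Plus) (simp_all add: midx_exponent_def midx_deg_def)

lemma prod_midx_exponent:
  fixes z :: "'n::finite + 'n \<Rightarrow> complex"
  shows "(\<Prod>i\<in>UNIV. z i ^ midx_exponent k i) = mono_eval (polydisc_point z) k"
  by (subst UNIV_Plus_UNIV [symmetric], subst prod.Plus)
     (simp_all add: midx_exponent_def mono_eval_def polydisc_point_def)

lemma polydisc_point_mem: "polydisc_point z \<in> polydisc \<rho> \<longleftrightarrow> (\<forall>i. cmod (z i) < \<rho>)"
proof
  assume "polydisc_point z \<in> polydisc \<rho>"
  then show "\<forall>i. cmod (z i) < \<rho>"
    by (simp add: polydisc_point_def polydisc_def) (metis sum.exhaust)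
qed (auto simp: polydisc_point_def polydisc_def)

lemma mono_eval_add: "mono_eval z (k + l) = mono_eval z k * mono_eval z l"
  by (simp add: mono_eval_def power_add prod.distrib)

lemma norm_mono_eval_le:
  assumes "\<And>i. cmod (z i) \<le> r"
  shows "cmod (mono_eval (polydisc_point z) k) \<le> r ^ midx_deg k"
proof -
  have "(\<Prod>i\<in>UNIV. cmod (z i) ^ midx_exponent k i) \<le> (\<Prod>i\<in>UNIV. r ^ midx_exponent k i)"
    by (intro prod_mono conjI power_mono assms) auto
  then show ?thesis
    by (simp add: prod_midx_exponent [symmetric] prod_norm [symmetric] norm_power
        power_sum [symmetric] sum_midx_exponent)
qed

lemma summable_on_power_midx_deg:
  fixes x :: real
  assumes "0 \<le> x" "x < 1"
  shows "(\<lambda>k :: 'n::finite midx. x ^ midx_deg k) summable_on UNIV"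
  using summable_on_geometric_multi[OF inj_midx_exponent assms] by (simp add: sum_midx_exponent)

lemma Cauchy_estimate_A_space:
  assumes H: "H \<in> A_space \<rho>" and r: "0 < r" "r < \<rho>"
    and bound: "\<And>z. z \<in> polydisc \<rho> \<Longrightarrow> cmod (series_eval H z) \<le> C"
  shows "cmod (H k) * r ^ midx_deg k \<le> C"
proof -
  \<comment> \<open>Convergence at the one point with all coordinates r suffices: unordered
    summability of complex numbers is absolute.\<close>
  have sm: "(\<lambda>k. norm (H k * mono_eval (polydisc_point (\<lambda>_. of_real r)) k)) summable_on UNIV"
  proof -
    have "(\<lambda>k. H k * mono_eval (polydisc_point (\<lambda>_. of_real r)) k) summable_on UNIV"
      using H r by (simp add: A_space_def polydisc_point_mem)
    then show ?thesis by (simp only: summable_on_iff_abs_summable_on_complex)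
  qed
  have eq: "norm (mono_eval (polydisc_point (\<lambda>_. of_real r)) k) = r ^ midx_deg k" for k
    using r by (simp add: prod_midx_exponent [symmetric] power_sum [symmetric] sum_midx_exponent norm_power)
  show ?thesis
    using Cauchy_estimate_multi[OF inj_midx_exponent, of r H C k] sm r bound
    by (simp add: eq norm_mult sum_midx_exponent prod_midx_exponent series_eval_def polydisc_point_mem)
qed

text \<open>The coefficient bound gives absolute convergence at every radius r < R by comparison
  with a geometric series of ratio r / R, as the identity theorem requires.\<close>

lemma series_eq_0_of_eval_eq_0:
  assumes bound: "\<And>k. cmod (H k) * R ^ midx_deg k \<le> C" and R: "R > 0"
    and z0: "\<And>i. z0 i \<noteq> 0" "\<And>i. cmod (z0 i) < R"
    and \<eta>: "\<eta> > 0"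
    and zero: "\<And>z. (\<And>i. cmod (z i - z0 i) < \<eta>) \<Longrightarrow> series_eval H (polydisc_point z) = 0"
  shows "H k = 0"
proof (rule power_series_identity_multi[OF inj_midx_exponent R _ z0 \<eta>])
  fix r :: real assume r: "0 \<le> r" "r < R"
  have "(\<lambda>k :: 'a midx. C * (r / R) ^ midx_deg k) summable_on UNIV"
    using r by (intro summable_on_cmult_right summable_on_power_midx_deg) auto
  then show "(\<lambda>k. norm (H k) * r ^ (\<Sum>i\<in>UNIV. midx_exponent k i)) summable_on UNIV"
  proof (rule summable_on_comparison_test)
    fix k
    have "norm (H k) * r ^ midx_deg k = norm (H k) * R ^ midx_deg k * (r / R) ^ midx_deg k"
      using R by (simp add: power_divide)
    also have "\<dots> \<le> C * (r / R) ^ midx_deg k"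
      using r R by (intro mult_right_mono bound) auto
    finally show "norm (H k) * r ^ (\<Sum>i\<in>UNIV. midx_exponent k i) \<le> C * (r / R) ^ midx_deg k"
      by (simp add: sum_midx_exponent)
  qed (use r in auto)
next
  fix z assume "\<And>i. cmod (z i - z0 i) < \<eta>"
  from zero[OF this] show "(\<Sum>\<^sub>\<infinity>k. H k * (\<Prod>i\<in>UNIV. z i ^ midx_exponent k i)) = 0"
    by (simp add: series_eval_def prod_midx_exponent)
qed

section \<open>Cauchy products and termwise differentiation\<close>

lemma
  fixes f g :: "'n::finite midx \<Rightarrow> complex"
  assumes f: "(\<lambda>l. cmod (f l)) summable_on UNIV" and g: "(\<lambda>m. cmod (g m)) summable_on UNIV"
  shows infsum_splittings: "(\<Sum>\<^sub>\<infinity>k. \<Sum>(l, m) | l + m = k. f l * g m) = infsum f UNIV * infsum g UNIV"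
    and summable_on_splittings: "(\<lambda>k. \<Sum>(l, m) | l + m = k. cmod (f l) * cmod (g m)) summable_on UNIV"
proof -
  \<comment> \<open>The absolutely summable double series over all pairs is regrouped into the
    finite fibres of addition.\<close>
  define S where "S = (SIGMA k : UNIV. {(l, m). l + m = (k :: 'n midx)})"
  have bij: "bij_betw (\<lambda>(l, m). (l + m, (l, m))) (UNIV \<times> UNIV) S"
    by (auto simp: bij_betw_def inj_on_def S_def image_iff)
  define h where "h = (\<lambda>(l, m). f l * g m)"
  have snd_bij: "(\<lambda>x. u (snd (case x of (l, m) \<Rightarrow> (l + m, (l, m))))) = u"
    for u :: "'n midx \<times> 'n midx \<Rightarrow> 'b"
    by (auto simp: fun_eq_iff)
  have "(\<lambda>(l, m). cmod (f l) * cmod (g m)) summable_on (UNIV \<times> UNIV)"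
  proof (rule summable_on_SigmaI)
    show "((\<lambda>m. case (l, m) of (l, m) \<Rightarrow> cmod (f l) * cmod (g m)) has_sum
        cmod (f l) * (\<Sum>\<^sub>\<infinity>m. cmod (g m))) UNIV" for l
      using g by (auto intro!: has_sum_cmult_right)
    show "(\<lambda>l. cmod (f l) * (\<Sum>\<^sub>\<infinity>m. cmod (g m))) summable_on UNIV"
      using f by (intro summable_on_cmult_left)
  qed auto
  then have abs: "(\<lambda>x. cmod (h x)) summable_on (UNIV \<times> UNIV)"
    by (simp add: h_def norm_mult case_prod_unfold)
  then have abs_S: "(\<lambda>x. cmod (h (snd x))) summable_on S"
    using summable_on_reindex_bij_betw[OF bij, of "\<lambda>x. cmod (h (snd x))"]
    unfolding snd_bij[of "\<lambda>x. cmod (h x)"] by blast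
  have prod: "h summable_on (UNIV \<times> UNIV)"
    using abs by (rule abs_summable_summable)
  have prod_S: "(\<lambda>x. h (snd x)) summable_on S"
    using abs_S by (rule abs_summable_summable)
  have "infsum f UNIV * infsum g UNIV = (\<Sum>\<^sub>\<infinity>l. f l * infsum g UNIV)"
    by (simp only: infsum_cmult_left')
  also have "\<dots> = (\<Sum>\<^sub>\<infinity>l. \<Sum>\<^sub>\<infinity>m. h (l, m))"
    by (simp add: h_def infsum_cmult_right')
  also have "\<dots> = infsum h (UNIV \<times> UNIV)"
    by (rule infsum_Sigma_banach[OF prod])
  also have "\<dots> = infsum (\<lambda>x. h (snd x)) S"
    using infsum_reindex_bij_betw[OF bij, of "\<lambda>x. h (snd x)"] unfolding snd_bij[of h] .
  also have "\<dots> = (\<Sum>\<^sub>\<infinity>k. infsum h {(l, m). l + m = k})"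
    using infsum_Sigma_banach[OF prod_S[unfolded S_def]] by (simp add: S_def)
  also have "\<dots> = (\<Sum>\<^sub>\<infinity>k. \<Sum>(l, m) | l + m = k. f l * g m)"
    by (simp add: finite_midx_splittings h_def)
  finally show "(\<Sum>\<^sub>\<infinity>k. \<Sum>(l, m) | l + m = k. f l * g m) = infsum f UNIV * infsum g UNIV" ..
  have "(\<lambda>k. \<Sum>\<^sub>\<infinity>x\<in>{(l, m). l + m = k}. cmod (h x)) summable_on UNIV"
    using summable_on_Sigma_banach[of "\<lambda>k x. cmod (h x)" UNIV "\<lambda>k. {(l, m). l + m = k}"] abs_S
    by (simp add: S_def case_prod_unfold)
  then show "(\<lambda>k. \<Sum>(l, m) | l + m = k. cmod (f l) * cmod (g m)) summable_on UNIV"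
    unfolding infsum_finite[OF finite_midx_splittings]
    by (simp add: h_def norm_mult case_prod_unfold)
qed

lemma series_mult_mono_eval:
  "series_mult F G k * mono_eval z k =
    (\<Sum>(l, m) | l + m = k. (F l * mono_eval z l) * (G m * mono_eval z m))"
proof -
  have "F l * G m * mono_eval z k = (F l * mono_eval z l) * (G m * mono_eval z m)" if "l + m = k" for l m
    by (simp add: that [symmetric] mono_eval_add mult_ac)
  then show ?thesis
    unfolding series_mult_def sum_distrib_right by (intro sum.cong refl) (simp add: case_prod_unfold)
qed

text \<open>A bijection with the naturals reduces the unordered sums to ordinary series, whose
  derivatives converge uniformly by the M-test; hence the infinite countable index type.\<close>

lemma has_vector_derivative_infsum:
  fixes u u' :: "'k::countable \<Rightarrow> real \<Rightarrow> complex"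
  assumes inf: "infinite (UNIV :: 'k set)" and S: "convex S" "s \<in> S"
    and deriv: "\<And>k s. s \<in> S \<Longrightarrow> (u k has_vector_derivative u' k s) (at s within S)"
    and bound: "\<And>k s. s \<in> S \<Longrightarrow> cmod (u' k s) \<le> M k" and M: "M summable_on UNIV"
    and sm: "\<And>s. s \<in> S \<Longrightarrow> (\<lambda>k. u k s) summable_on UNIV"
  shows "((\<lambda>s. \<Sum>\<^sub>\<infinity>k. u k s) has_vector_derivative (\<Sum>\<^sub>\<infinity>k. u' k s)) (at s within S)"
proof -
  define b where "b = from_nat_into (UNIV :: 'k set)"
  have b: "bij_betw b UNIV UNIV"
    unfolding b_def using inf by (intro bij_betw_from_nat_into) auto
  have sums: "(\<lambda>n. v (b n)) sums infsum v UNIV" if "v summable_on UNIV" for v :: "'k \<Rightarrow> complex"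
    using that by (intro has_sum_imp_sums) (simp add: has_sum_reindex_bij_betw[OF b])
  have summable_u': "(\<lambda>k. u' k s) summable_on UNIV" if "s \<in> S" for s
    by (rule abs_summable_summable, rule Infinite_Sum.abs_summable_on_comparison_test'[OF M])
       (rule bound[OF that])
  have "M \<circ> b summable_on UNIV"
    using M summable_on_reindex_bij_betw[OF b, of M] by (simp add: o_def)
  then have "summable (\<lambda>n. M (b n))"
    by (auto dest: summable_on_imp_summable simp: o_def)
  then have "uniform_limit S (\<lambda>n s. \<Sum>i<n. u' (b i) s) (\<lambda>s. \<Sum>i. u' (b i) s) sequentially"
    by (intro Weierstrass_m_test[where M = "\<lambda>n. M (b n)"]) (auto intro: bound)
  then have ul: "uniform_limit S (\<lambda>n s. \<Sum>i<n. u' (b i) s) (\<lambda>s. \<Sum>\<^sub>\<infinity>k. u' k s) sequentially"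
    by (rule uniform_limit_cong'[THEN iffD1, rotated 2]) (use sums[OF summable_u'] in \<open>auto simp: sums_iff\<close>)
  have "\<exists>g. \<forall>s\<in>S. (\<lambda>n. u (b n) s) sums g s \<and>
      (g has_derivative (\<lambda>h. h *\<^sub>R (\<Sum>\<^sub>\<infinity>k. u' k s))) (at s within S)"
  proof (rule has_derivative_series[where f = "\<lambda>n. u (b n)" and f' = "\<lambda>n s h. h *\<^sub>R u' (b n) s"])
    show "convex S" "s \<in> S" by (fact S)+
    show "(\<lambda>n. u (b n) s) sums (\<Sum>\<^sub>\<infinity>k. u k s)" by (intro sums sm S)
    show "(u (b n) has_derivative (\<lambda>h. h *\<^sub>R u' (b n) s)) (at s within S)" if "s \<in> S" for n s
      using deriv[OF that] by (simp add: has_vector_derivative_def)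
    fix e :: real assume "e > 0"
    from uniform_limitD[OF ul this]
    show "\<forall>\<^sub>F n in sequentially. \<forall>s\<in>S. \<forall>h.
        cmod ((\<Sum>i<n. h *\<^sub>R u' (b i) s) - h *\<^sub>R (\<Sum>\<^sub>\<infinity>k. u' k s)) \<le> e * norm h"
    proof eventually_elim
      case (elim n)
      show ?case
      proof (intro ballI allI)
        fix s h assume "s \<in> S"
        then have "cmod ((\<Sum>i<n. u' (b i) s) - (\<Sum>\<^sub>\<infinity>k. u' k s)) \<le> e"
          using elim by (auto simp: dist_norm less_imp_le)
        then show "cmod ((\<Sum>i<n. h *\<^sub>R u' (b i) s) - h *\<^sub>R (\<Sum>\<^sub>\<infinity>k. u' k s)) \<le> e * norm h"
          by (simp add: scaleR_sum_right [symmetric] scaleR_diff_right [symmetric] mult.commute[of e] mult_left_mono)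
      qed
    qed
  qed
  then obtain g where g: "\<And>s. s \<in> S \<Longrightarrow> (\<lambda>n. u (b n) s) sums g s"
    "\<And>s. s \<in> S \<Longrightarrow> (g has_derivative (\<lambda>h. h *\<^sub>R (\<Sum>\<^sub>\<infinity>k. u' k s))) (at s within S)"
    by blast
  have eq: "(\<Sum>\<^sub>\<infinity>k. u k s) = g s" if "s \<in> S" for s
    using sums[OF sm[OF that]] g(1)[OF that] by (rule sums_unique2)
  have "((\<lambda>s. \<Sum>\<^sub>\<infinity>k. u k s) has_derivative (\<lambda>h. h *\<^sub>R (\<Sum>\<^sub>\<infinity>k. u' k s))) (at s within S)"
    by (rule has_derivative_transform[OF S(2) eq g(2)[OF S(2)]])
  then show ?thesis by (simp add: has_vector_derivative_def)
qed

lemma infinite_UNIV_midx: "infinite (UNIV :: 'n::finite midx set)"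
proof
  assume "finite (UNIV :: 'n midx set)"
  moreover have "inj (\<lambda>m. (\<chi> i. m, 0) :: 'n midx)"
    by (auto simp: inj_def vec_eq_iff)
  ultimately have "finite (UNIV :: nat set)"
    using finite_imageD[of "\<lambda>m. (\<chi> i. m, 0) :: 'n midx" UNIV] rev_finite_subset by blast
  then show False by simp
qed

text \<open>At a fixed z the value y of the series solves y' = - \<alpha> y, where Re \<alpha> < 0.
  It grows exponentially unless it starts at 0, while the majorant M keeps it bounded for all
  time.\<close>

lemma bounded_solution_eval_eq_0:
  fixes h :: "real \<Rightarrow> 'n::finite series" and a :: "'n series"
  assumes ode: "\<And>k s. s \<ge> 0 \<Longrightarrow>
      ((\<lambda>s. h s k) has_vector_derivative - series_mult a (h s) k) (at s within {0..})"
    and bound: "\<And>k s. s \<ge> 0 \<Longrightarrow> cmod (h s k * mono_eval z k) \<le> M k" and M: "M summable_on UNIV"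
    and a: "(\<lambda>l. cmod (a l * mono_eval z l)) summable_on UNIV"
    and neg: "Re (series_eval a z) < 0"
  shows "series_eval (h 0) z = 0"
proof -
  define \<alpha> where "\<alpha> = series_eval a z"
  have M0: "M k \<ge> 0" for k
    using order_trans[OF norm_ge_zero bound[of 0 k]] by simp
  have hs: "(\<lambda>k. cmod (h s k * mono_eval z k)) summable_on UNIV" if "s \<ge> 0" for s
    by (rule Infinite_Sum.abs_summable_on_comparison_test'[OF M]) (rule bound[OF that])
  \<comment> \<open>Majorant of the time derivatives, uniform in s: the Cauchy product of the
    absolute values of a with M.\<close>
  define N where "N k = (\<Sum>(l, m) | l + m = k. cmod (a l * mono_eval z l) * cmod (of_real (M m)))" for k
  have N: "N summable_on UNIV"
    unfolding N_def by (rule summable_on_splittings[OF a]) (use M M0 in simp)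
  have deriv: "((\<lambda>s. series_eval (h s) z) has_vector_derivative - \<alpha> * series_eval (h s) z) (at s within {0..})"
    if s: "s \<ge> 0" for s
  proof -
    have "((\<lambda>s. \<Sum>\<^sub>\<infinity>k. h s k * mono_eval z k) has_vector_derivative
        (\<Sum>\<^sub>\<infinity>k. - series_mult a (h s) k * mono_eval z k)) (at s within {0..})"
    proof (rule has_vector_derivative_infsum[OF infinite_UNIV_midx _ _ _ _ N])
      fix k :: "'n midx" and s :: real assume s: "s \<in> {0..}"
      show "((\<lambda>s. h s k * mono_eval z k) has_vector_derivative
          - series_mult a (h s) k * mono_eval z k) (at s within {0..})"
        using ode[of s k] s by (intro has_vector_derivative_mult_left) simp
      have "cmod (- series_mult a (h s) k * mono_eval z k) = cmod (series_mult a (h s) k * mono_eval z k)"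
        by simp
      also have "\<dots> \<le> N k"
        unfolding series_mult_mono_eval N_def case_prod_unfold
      proof (rule sum_norm_le)
        fix x :: "'n midx \<times> 'n midx"
        have "cmod (h s (snd x) * mono_eval z (snd x)) \<le> cmod (of_real (M (snd x)))"
          using bound[of s "snd x"] s M0[of "snd x"] by simp
        then show "cmod (a (fst x) * mono_eval z (fst x) * (h s (snd x) * mono_eval z (snd x))) \<le>
            cmod (a (fst x) * mono_eval z (fst x)) * cmod (of_real (M (snd x)))"
          unfolding norm_mult[of "a (fst x) * mono_eval z (fst x)"] by (rule mult_left_mono) simp
      qed
      finally show "cmod (- series_mult a (h s) k * mono_eval z k) \<le> N k" .
    next
      fix s :: real assume "s \<in> {0..}"
      then show "(\<lambda>k. h s k * mono_eval z k) summable_on UNIV"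
        using abs_summable_summable[OF hs[of s]] by simp
    qed (use s in auto)
    moreover have "(\<Sum>\<^sub>\<infinity>k. - series_mult a (h s) k * mono_eval z k) = - \<alpha> * series_eval (h s) z"
      using infsum_splittings[OF a hs[OF s]]
      by (simp add: series_mult_mono_eval infsum_uminus \<alpha>_def series_eval_def)
    ultimately show ?thesis by (simp add: series_eval_def)
  qed
  have growth: "cmod (series_eval (h 0) z) * exp (- Re \<alpha> * s) \<le> infsum M UNIV" if s: "s \<ge> 0" for s
  proof -
    have "series_eval (h s) z = exp (- \<alpha> * of_real s) * series_eval (h 0) z"
      by (rule linear_ode_unique[OF deriv s])
    moreover have "cmod (series_eval (h s) z) \<le> infsum M UNIV"
      unfolding series_eval_def
      by (rule norm_infsum_le[OF has_sum_infsum has_sum_infsum])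
         (use M bound[OF s] abs_summable_summable[OF hs[OF s]] in auto)
    ultimately show ?thesis by (simp add: norm_mult mult.commute)
  qed
  show ?thesis
  proof (rule ccontr)
    assume nz: "series_eval (h 0) z \<noteq> 0"
    define d where "d = cmod (series_eval (h 0) z)"
    define \<beta> where "\<beta> = - Re \<alpha>"
    \<comment> \<open>At this time the linear lower bound d (1 + \<beta> s) of the exponential
      already equals d plus the sum of M, which exceeds the permitted bound.\<close>
    define s where "s = infsum M UNIV / (d * \<beta>)"
    have d: "d > 0" using nz by (simp add: d_def)
    have \<beta>: "\<beta> > 0" using neg by (simp add: \<beta>_def \<alpha>_def)
    have "infsum M UNIV \<ge> 0" by (intro infsum_nonneg M0)
    then have "s \<ge> 0" using d \<beta> by (simp add: s_def)
    have "d + infsum M UNIV = d * (1 + \<beta> * s)"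
      using d \<beta> by (simp add: s_def field_simps)
    also have "\<dots> \<le> d * exp (\<beta> * s)"
      using d by (intro mult_left_mono exp_ge_add_one_self) auto
    also have "\<dots> \<le> infsum M UNIV"
      using growth[OF \<open>s \<ge> 0\<close>] by (simp add: d_def \<beta>_def)
    finally show False using d by simp
  qed
qed

section \<open>The multiplier\<close>

lemma fst_midx_kappa: "fst (midx_kappa i) $ j = (if j = i then 1 else 0)"
  by (simp add: midx_kappa_def axis_def)

lemma midx_deg_0 [simp]: "midx_deg 0 = 0"
  by (simp add: midx_deg_def)

lemma series_mult_kappa:
  fixes k :: "'n::finite midx"
  shows "series_mult (kappa j) (kappa i) k = (if k = midx_kappa j + midx_kappa i then 1 else 0)"
proof -
  have "series_mult (kappa j) (kappa i) k =
      (\<Sum>x | fst x + snd x = k. if x = (midx_kappa j, midx_kappa i) then 1 else 0)"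
    unfolding series_mult_def kappa_def midx_kappa_def [symmetric] case_prod_unfold
    by (intro sum.cong refl) (simp add: prod_eq_iff[of _ "(midx_kappa j, midx_kappa i)"])
  also have "\<dots> = (if k = midx_kappa j + midx_kappa i then 1 else 0)"
    using finite_midx_splittings[of k] by (subst sum.delta) (auto simp: case_prod_unfold)
  finally show ?thesis .
qed

text \<open>Product rule for \<kappa>_j \<kappa>_i. For i = j = m both summands contribute and give
  the factor 2 of a square.\<close>

lemma kappa_deriv_product:
  "of_nat (fst l $ m + 1) * (if l + midx_kappa m = midx_kappa j + midx_kappa i then 1 else 0) =
    (if m = i then if l = midx_kappa j then 1 else 0 else 0) +
    (if m = j then if l = midx_kappa i then 1 else 0 else (0::complex))"
proof -
  consider "m = i" | "m \<noteq> i" "m = j" | "m \<noteq> i" "m \<noteq> j" by blast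
  then show ?thesis
  proof cases
    case 1
    then show ?thesis by (cases "l = midx_kappa j") (auto simp: fst_midx_kappa)
  next
    case 2
    then have "l + midx_kappa m = midx_kappa j + midx_kappa i \<longleftrightarrow> l = midx_kappa i"
      by (metis add.commute add_left_imp_eq)
    then show ?thesis using 2 by (auto simp: fst_midx_kappa)
  next
    case 3
    have "l + midx_kappa m \<noteq> midx_kappa j + midx_kappa i"
    proof
      assume "l + midx_kappa m = midx_kappa j + midx_kappa i"
      from arg_cong[OF this, of "\<lambda>k. fst k $ m"] show False
        using 3 by (simp add: fst_midx_kappa)
    qed
    then show ?thesis using 3 by simp
  qed
qed

text \<open>Symmetry of the matrix merges the two terms of the product rule into the factor 2, and
  then moves A from \<kappa> to q.\<close>

lemma kappa_deriv_kappa_form: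
  assumes A: "linear A" "adjoint A = A"
  shows "(\<Sum>m\<in>UNIV. of_int (q $ m) * kappa_deriv m (kappa_form A) l) =
    2 * (\<Sum>i\<in>UNIV. if l = midx_kappa i then of_real (A (rvec q) $ i) else 0)"
proof -
  have "transpose (matrix A) = matrix A"
    using matrix_adjoint[OF A(1)] A(2) by simp
  moreover have "transpose (matrix A) $ i $ j = matrix A $ j $ i" for i j
    by (simp add: transpose_def)
  ultimately have sym: "matrix A $ i $ j = matrix A $ j $ i" for i j by simp
  have "A (rvec q) = matrix A *v rvec q"
    using fun_cong[OF matrix_vector_mul(2)[OF A(1)], of "rvec q"] by simp
  then have Aq: "A (rvec q) $ i = (\<Sum>m\<in>UNIV. matrix A $ i $ m * of_int (q $ m))" for i
    by (simp add: matrix_vector_mult_def rvec_def)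
  define u :: "'a \<Rightarrow> complex" where "u i = (if l = midx_kappa i then 1 else 0)" for i
  have "kappa_deriv m (kappa_form A) l =
      2 * (\<Sum>i\<in>UNIV. of_real (matrix A $ i $ m) * u i)" for m
  proof -
    have "kappa_deriv m (kappa_form A) l = (\<Sum>i\<in>UNIV. \<Sum>j\<in>UNIV. of_real (matrix A $ i $ j) *
        (of_nat (fst l $ m + 1) * (if l + midx_kappa m = midx_kappa j + midx_kappa i then 1 else 0)))"
      by (simp only: kappa_deriv_def kappa_form_def series_mult_kappa sum_distrib_left mult.left_commute)
    also have "\<dots> = (\<Sum>i\<in>UNIV. \<Sum>j\<in>UNIV.
        (if m = i then of_real (matrix A $ i $ j) * u j else 0) +
        (if m = j then of_real (matrix A $ i $ j) * u i else 0))"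
      unfolding kappa_deriv_product u_def by (intro sum.cong refl) simp
    also have "\<dots> = (\<Sum>j\<in>UNIV. \<Sum>i\<in>UNIV. if m = i then of_real (matrix A $ i $ j) * u j else 0) +
        (\<Sum>i\<in>UNIV. \<Sum>j\<in>UNIV. if m = j then of_real (matrix A $ i $ j) * u i else 0)"
      unfolding sum.distrib by (subst sum.swap) (rule refl)
    also have "\<dots> = 2 * (\<Sum>i\<in>UNIV. of_real (matrix A $ i $ m) * u i)"
      by (simp add: sym[of m])
    finally show ?thesis .
  qed
  then have "(\<Sum>m\<in>UNIV. of_int (q $ m) * kappa_deriv m (kappa_form A) l) =
      (\<Sum>m\<in>UNIV. \<Sum>i\<in>UNIV. 2 * (of_real (matrix A $ i $ m * of_int (q $ m)) * u i))"
    by (simp add: sum_distrib_left mult_ac)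
  also have "\<dots> = (\<Sum>i\<in>UNIV. 2 * (of_real (A (rvec q) $ i) * u i))"
    by (subst sum.swap) (simp add: Aq sum_distrib_left sum_distrib_right)
  also have "\<dots> = 2 * (\<Sum>i\<in>UNIV. if l = midx_kappa i then of_real (A (rvec q) $ i) else 0)"
    unfolding sum_distrib_left u_def by (intro sum.cong refl) simp
  finally show ?thesis .
qed

section \<open>Values of the multiplier near the origin\<close>

lemma kappa_form_eq_0: "midx_deg k \<noteq> 4 \<Longrightarrow> kappa_form A k = 0"
  unfolding kappa_form_def series_mult_kappa by (auto intro!: sum.neutral)

lemma mono_eval_0 [simp]: "mono_eval z 0 = 1"
  by (simp add: mono_eval_def)

lemma mono_eval_kappa: "mono_eval (polydisc_point z) (midx_kappa i) = z (Inl i) * z (Inr i)"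
proof -
  have "(\<Prod>j\<in>UNIV. x j ^ (axis i 1 $ j)) = x i" for x :: "'a \<Rightarrow> complex"
  proof -
    have "(\<Prod>j\<in>UNIV. x j ^ (axis i 1 $ j)) = (\<Prod>j\<in>UNIV. if j = i then x j else 1)"
      by (intro prod.cong refl) (simp add: axis_def)
    then show ?thesis by (simp add: prod.delta)
  qed
  then show ?thesis by (simp add: mono_eval_def midx_kappa_def polydisc_point_def)
qed

lemma has_sum_single:
  fixes c :: "'b::{topological_comm_monoid_add, t2_space}"
  shows "((\<lambda>x. if x = p then c else 0) has_sum c) UNIV"
  by (rule has_sum_finite_neutralI[of "{p}"]) auto

text \<open>The part of F beyond the quadratic form starts in degree 6 in the z variables, so its
  \<kappa>-derivatives start in degree 4; this yields the fourth power of \<tau>, against the square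
  in the main term.\<close>

lemma flow_symbol_eval:
  fixes F :: "'n::finite series" and z :: "'n + 'n \<Rightarrow> complex" and q :: "int ^ 'n"
  assumes A: "linear A" "adjoint A = A"
    and F: "(\<lambda>k. F k - 1 / 2 * kappa_form A k) \<in> O_kappa 3"
    and bound: "\<And>k. cmod (F k) * R ^ midx_deg k \<le> C" and R: "R > 0"
    and \<tau>: "0 \<le> \<tau>" "\<tau> \<le> R / 4" and z: "\<And>i. cmod (z i) \<le> \<tau>"
  shows "(\<lambda>l. cmod (flow_symbol \<omega> q F l * mono_eval (polydisc_point z) l)) summable_on UNIV"
      (is ?summable)
    and "cmod (series_eval (flow_symbol \<omega> q F) (polydisc_point z) -
        (of_real (\<omega> \<bullet> rvec q) + (\<Sum>i\<in>UNIV. of_real (A (rvec q) $ i) * (z (Inl i) * z (Inr i)))))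
      \<le> l1_norm (rvec q) * (C / R\<^sup>2 * (16 * (2 * \<tau> / R) ^ 4) * (\<Sum>\<^sub>\<infinity>k :: 'n midx. (1 / 2) ^ midx_deg k))"
      (is ?estimate)
proof -
  define g where "g k = F k - 1 / 2 * kappa_form A k" for k
  define rest where "rest l = (\<Sum>j\<in>UNIV. of_int (q $ j) * kappa_deriv j g l)" for l
  define main where "main l = (if l = 0 then of_real (\<omega> \<bullet> rvec q) else 0) +
    (\<Sum>i\<in>UNIV. if l = midx_kappa i then complex_of_real (A (rvec q) $ i) else 0)" for l
  define w where "w = mono_eval (polydisc_point z)"
  \<comment> \<open>The factor 2 absorbs the exponents produced by differentiation, as these are at
    most 2 ^ d in degree d; \<tau> \<le> R / 4 still leaves x \<le> 1 / 2.\<close>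
  define x where "x = 2 * \<tau> / R"
  have x: "0 \<le> x" "x \<le> 1 / 2" using \<tau> R by (simp_all add: x_def field_simps)
  have C: "C \<ge> 0"
    using order_trans[OF _ bound[of 0], of 0] by simp
  have split: "flow_symbol \<omega> q F l = main l + rest l" for l
  proof -
    have "kappa_deriv j F l = 1 / 2 * kappa_deriv j (kappa_form A) l + kappa_deriv j g l" for j
      by (simp add: kappa_deriv_def g_def algebra_simps)
    then have "(\<Sum>j\<in>UNIV. of_int (q $ j) * kappa_deriv j F l) =
        1 / 2 * (\<Sum>j\<in>UNIV. of_int (q $ j) * kappa_deriv j (kappa_form A) l) + rest l"
      by (simp add: rest_def sum.distrib [symmetric] sum_distrib_left algebra_simps)
    then show ?thesis
      by (simp add: flow_symbol_def main_def kappa_deriv_kappa_form[OF A])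
  qed
  have g6: "midx_deg k \<ge> 6" if "g k \<noteq> 0" for k
  proof -
    have "fst k = snd k" "(\<Sum>j\<in>UNIV. fst k $ j) \<ge> 3"
      using F that unfolding O_kappa_def g_def by blast+
    then show ?thesis by (simp add: midx_deg_def)
  qed
  \<comment> \<open>Where g is nonzero the degree is at least 6, so the quadratic form, which lives
    in degree 4, is absent and g coincides with F.\<close>
  have g: "cmod (g k) * R ^ midx_deg k \<le> C" for k
  proof (cases "g k = 0")
    case False
    then have "kappa_form A k = 0" using g6[of k] by (intro kappa_form_eq_0) auto
    then show ?thesis using bound[of k] by (simp add: g_def)
  qed (use C in simp)
  have deriv: "cmod (kappa_deriv j g l) * \<tau> ^ midx_deg l \<le> C / R\<^sup>2 * (16 * x ^ 4) * (1 / 2) ^ midx_deg l" for j l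
  proof (cases "g (l + midx_kappa j) = 0")
    case True
    then show ?thesis using C R x by (simp add: kappa_deriv_def)
  next
    case False
    define d where "d = midx_deg l"
    have d: "d \<ge> 4" using g6[OF False] by (simp add: d_def)
    have "fst l $ j \<le> d"
      unfolding d_def midx_deg_def by (rule order_trans[OF member_le_sum[of j UNIV] le_add1]) auto
    then have "real (fst l $ j + 1) \<le> 2 ^ d"
      using less_exp[of d] by (metis Suc_eq_plus1 Suc_leI le_less_trans of_nat_le_iff of_nat_numeral of_nat_power)
    moreover have "cmod (g (l + midx_kappa j)) \<le> C / (R ^ d * R\<^sup>2)"
      using g[of "l + midx_kappa j"] R by (simp add: d_def power_add power2_eq_square field_simps)
    moreover have "cmod (kappa_deriv j g l) = real (fst l $ j + 1) * cmod (g (l + midx_kappa j))"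
      unfolding kappa_deriv_def norm_mult norm_of_nat ..
    ultimately have "cmod (kappa_deriv j g l) \<le> 2 ^ d * (C / (R ^ d * R\<^sup>2))"
      by (metis mult_mono norm_ge_zero zero_le_numeral zero_le_power)
    then have "cmod (kappa_deriv j g l) * \<tau> ^ d \<le> 2 ^ d * (C / (R ^ d * R\<^sup>2)) * \<tau> ^ d"
      using \<tau> by (intro mult_right_mono) auto
    also have "\<dots> = C / R\<^sup>2 * x ^ d"
      by (simp add: x_def power_divide power_mult_distrib mult_ac)
    \<comment> \<open>Four powers of x are kept for smallness; the others are traded for powers of 1
      / 2, whose shift by 4 costs the factor 16.\<close>
    also have "x ^ d = x ^ 4 * x ^ (d - 4)"
      using d by (simp flip: power_add)
    also have "C / R\<^sup>2 * (x ^ 4 * x ^ (d - 4)) \<le> C / R\<^sup>2 * (x ^ 4 * (1 / 2) ^ (d - 4))"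
      using C x by (intro mult_left_mono power_mono) auto
    also have "(1 / 2 :: real) ^ (d - 4) = 16 * (1 / 2) ^ d"
      using d by (simp add: power_diff power4_eq_xxxx)
    finally show ?thesis by (simp add: d_def mult_ac)
  qed
  have rest: "cmod (rest l * w l) \<le> l1_norm (rvec q) * (C / R\<^sup>2 * (16 * x ^ 4)) * (1 / 2) ^ midx_deg l" for l
  proof -
    have "cmod (rest l * w l) \<le> cmod (rest l) * \<tau> ^ midx_deg l"
      unfolding norm_mult w_def by (intro mult_left_mono norm_mono_eval_le z) auto
    also have "\<dots> \<le> (\<Sum>j\<in>UNIV. \<bar>real_of_int (q $ j)\<bar> * cmod (kappa_deriv j g l)) * \<tau> ^ midx_deg l"
      using \<tau> unfolding rest_def
      by (intro mult_right_mono sum_norm_le) (auto simp: norm_mult)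
    also have "\<dots> = (\<Sum>j\<in>UNIV. \<bar>real_of_int (q $ j)\<bar> * (cmod (kappa_deriv j g l) * \<tau> ^ midx_deg l))"
      by (simp add: sum_distrib_right mult.assoc)
    also have "\<dots> \<le> (\<Sum>j\<in>UNIV. \<bar>real_of_int (q $ j)\<bar> * (C / R\<^sup>2 * (16 * x ^ 4) * (1 / 2) ^ midx_deg l))"
      by (intro sum_mono mult_left_mono deriv) auto
    finally show ?thesis
      by (simp add: l1_norm_def rvec_def sum_distrib_right sum_divide_distrib mult.assoc)
  qed
  have geo: "(\<lambda>k :: 'n midx. (1 / 2 :: real) ^ midx_deg k) summable_on UNIV"
    by (rule summable_on_power_midx_deg) auto
  have rest_abs: "(\<lambda>l. cmod (rest l * w l)) summable_on UNIV"
    by (rule Infinite_Sum.abs_summable_on_comparison_test'[OF summable_on_cmult_right[OF geo]]) (rule rest)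
  have main: "((\<lambda>l. main l * w l) has_sum
      (of_real (\<omega> \<bullet> rvec q) + (\<Sum>i\<in>UNIV. of_real (A (rvec q) $ i) * (z (Inl i) * z (Inr i))))) UNIV"
  proof -
    have "main l * w l = (if l = 0 then of_real (\<omega> \<bullet> rvec q) else 0) +
        (\<Sum>i\<in>UNIV. if l = midx_kappa i then of_real (A (rvec q) $ i) * (z (Inl i) * z (Inr i)) else 0)" for l
    proof -
      have "(if l = 0 then of_real (\<omega> \<bullet> rvec q) else 0) * w l = (if l = 0 then of_real (\<omega> \<bullet> rvec q) else 0)"
        by (simp add: w_def)
      moreover have "(if l = midx_kappa i then of_real (A (rvec q) $ i) else 0) * w l =
          (if l = midx_kappa i then of_real (A (rvec q) $ i) * (z (Inl i) * z (Inr i)) else 0)" for i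
        by (simp add: w_def mono_eval_kappa)
      ultimately show ?thesis by (simp only: main_def distrib_right sum_distrib_right)
    qed
    then show ?thesis by (simp only:) (intro has_sum_add has_sum_sum has_sum_single)
  qed
  have total: "(\<lambda>l. flow_symbol \<omega> q F l * w l) = (\<lambda>l. main l * w l + rest l * w l)"
    by (simp add: split distrib_right)
  have sums: "(\<lambda>l. main l * w l) summable_on UNIV" "(\<lambda>l. rest l * w l) summable_on UNIV"
    using main abs_summable_summable[OF rest_abs] by (auto dest: has_sum_imp_summable)
  have "(\<lambda>l. flow_symbol \<omega> q F l * w l) summable_on UNIV"
    unfolding total by (intro summable_on_add sums)
  then show ?summable
    by (simp only: w_def summable_on_iff_abs_summable_on_complex)
  have "series_eval (flow_symbol \<omega> q F) (polydisc_point z) = (\<Sum>\<^sub>\<infinity>l. main l * w l) + (\<Sum>\<^sub>\<infinity>l. rest l * w l)"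
    unfolding series_eval_def w_def [symmetric] total by (intro infsum_add sums)
  moreover have "cmod (\<Sum>\<^sub>\<infinity>l. rest l * w l) \<le>
      l1_norm (rvec q) * (C / R\<^sup>2 * (16 * x ^ 4)) * (\<Sum>\<^sub>\<infinity>k :: 'n midx. (1 / 2) ^ midx_deg k)"
    by (rule norm_infsum_le[OF has_sum_infsum[OF sums(2)] has_sum_cmult_right[OF has_sum_infsum[OF geo]] rest])
  ultimately show ?estimate
    unfolding infsumI[OF main] by (simp add: x_def mult.assoc)
qed

section \<open>Unboundedness of the flow\<close>

theorem proposition6p3:
  fixes \<omega> :: "real ^ 'n::finite"
    and Hhat :: "'n series"
    and A :: "real ^ 'n \<Rightarrow> real ^ 'n"
    and c :: real
  assumes "nonresonant \<omega>"
    and "Hhat \<in> A_all \<inter> F_diamond"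
    and "series_support Hhat \<subseteq> {q. \<omega> \<bullet> rvec q \<ge> 0}"
    and "linear A" and "adjoint A = A"
    and "(\<lambda>k. series_part 0 Hhat k - 1 / 2 * kappa_form A k) \<in> O_kappa 3"
    and "c > 0"
    and "\<forall>\<epsilon>>0. \<exists>q\<in>series_support Hhat.
           \<bar>\<omega> \<bullet> rvec q\<bar> \<le> \<epsilon> * l1_norm (rvec q) \<and> l1_norm (A (rvec q)) > c * l1_norm (rvec q)"
  shows "\<forall>\<rho>>0. \<not> (\<exists>C::real. \<forall>\<delta>\<ge>0. A_norm \<rho> (phi \<omega> \<delta> Hhat) \<le> ereal C)"
proof (intro allI impI notI)
  fix \<rho> :: real
  assume \<rho>: "\<rho> > 0" and "\<exists>C::real. \<forall>\<delta>\<ge>0. A_norm \<rho> (phi \<omega> \<delta> Hhat) \<le> ereal C"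
  then obtain C where C: "\<And>\<delta>. \<delta> \<ge> 0 \<Longrightarrow> A_norm \<rho> (phi \<omega> \<delta> Hhat) \<le> ereal C" by blast
  obtain H where H: "flow_solution \<omega> Hhat H"
    using flow_solution_flow_coeff assms(2) by blast
  have H0: "H 0 = Hhat" using H by (simp add: flow_solution_def)
  \<comment> \<open>Any radius strictly below \<rho> serves, as Cauchy's estimate needs its torus
    inside the open polydisc.\<close>
  define R where "R = \<rho> / 2"
  have R: "R > 0" "R < \<rho>" using \<rho> by (simp_all add: R_def)
  have bound: "cmod (H \<delta> k) * R ^ midx_deg k \<le> C" if "\<delta> \<ge> 0" for \<delta> k
  proof (rule Cauchy_estimate_A_space[OF _ R])
    have norm: "A_norm \<rho> (H \<delta>) \<le> ereal C"
      using C[OF that] phi_eqI[OF H that] by simp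
    then show mem: "H \<delta> \<in> A_space \<rho>"
      by (auto simp: A_norm_def split: if_splits)
    fix z :: "(complex ^ 'n) \<times> (complex ^ 'n)" assume "z \<in> polydisc \<rho>"
    then have "ereal (cmod (series_eval (H \<delta>) z)) \<le> A_norm \<rho> (H \<delta>)"
      using mem by (simp add: A_norm_def) (rule SUP_upper)
    with norm show "cmod (series_eval (H \<delta>) z) \<le> C"
      by (metis ereal_less_eq(3) order_trans)
  qed
  have C0: "C \<ge> 0"
    using order_trans[OF _ bound[of 0 0], of 0] by simp
  define G where "G = (\<Sum>\<^sub>\<infinity>k :: 'n midx. (1 / 2 :: real) ^ midx_deg k)"
  have G: "G \<ge> 0" unfolding G_def by (intro infsum_nonneg) auto
  \<comment> \<open>The constant of \<open>flow_symbol_eval\<close> for \<tau> = 2 \<sigma>, with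
    \<sigma> ^ 4 and the l1 norm of q factored out. It involves neither q nor \<sigma>.\<close>
  define K where "K = C / R\<^sup>2 * (16 * (4 / R) ^ 4) * G"
  have K: "K \<ge> 0" using C0 R G by (simp add: K_def)
  \<comment> \<open>The first entry ensures 2 \<sigma> \<le> R / 4, the second K \<sigma>^2 \<le> c
    / 8; K + 1 keeps the denominator positive when K = 0.\<close>
  define \<sigma> where "\<sigma> = min (R / 8) (sqrt (c / (8 * (K + 1))))"
  have \<sigma>: "\<sigma> > 0" "\<sigma> \<le> R / 8"
    using R K assms(7) by (simp_all add: \<sigma>_def)
  have K\<sigma>: "K * \<sigma>\<^sup>2 \<le> c / 8"
  proof -
    have "\<sigma>\<^sup>2 \<le> (sqrt (c / (8 * (K + 1))))\<^sup>2"
      using \<sigma>(1) by (intro power_mono) (auto simp: \<sigma>_def)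
    also have "\<dots> = c / (8 * (K + 1))" using K assms(7) by simp
    finally have "(K + 1) * \<sigma>\<^sup>2 \<le> c / 8" using K by (simp add: field_simps)
    moreover have "K * \<sigma>\<^sup>2 \<le> (K + 1) * \<sigma>\<^sup>2" by (intro mult_right_mono) auto
    ultimately show ?thesis by linarith
  qed
  have "c * \<sigma>\<^sup>2 / 8 > 0" using \<sigma>(1) assms(7) by simp
  with assms(8) obtain q where q: "q \<in> series_support Hhat"
    and small: "\<bar>\<omega> \<bullet> rvec q\<bar> \<le> c * \<sigma>\<^sup>2 / 8 * l1_norm (rvec q)"
    and large: "l1_norm (A (rvec q)) > c * l1_norm (rvec q)"
    by blast
  \<comment> \<open>At q = 0 both sides of the strict inequality \<open>large\<close> would be
    0.\<close>
  have q0: "q \<noteq> 0"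
    using large linear_0[OF assms(4)] by (auto simp: l1_norm_def)
  have Q: "l1_norm (rvec q) > 0"
  proof -
    obtain j where "q $ j \<noteq> 0" using q0 by (auto simp: vec_eq_iff)
    then show ?thesis unfolding l1_norm_def
      by (intro sum_pos2[of _ j]) (auto simp: rvec_def)
  qed
  have \<omega>q: "\<omega> \<bullet> rvec q > 0"
    using assms(1,3) q q0 unfolding nonresonant_def by (metis less_eq_real_def mem_Collect_eq subsetD)
  define f where "f = series_part 0 Hhat"
  define a where "a = flow_symbol \<omega> q f"
  define h where "h s = series_part q (H s)" for s
  \<comment> \<open>A sign that takes the value 1 at zero components of A q: all coordinates of
    \<open>z0\<close> then have modulus \<sigma>, and the identity theorem needs them
    nonzero.\<close>
  define \<epsilon> :: "'n \<Rightarrow> real" where "\<epsilon> j = (if A (rvec q) $ j \<ge> 0 then 1 else - 1)" for j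
  define z0 :: "'n + 'n \<Rightarrow> complex"
    where "z0 = case_sum (\<lambda>j. - of_real (\<sigma> * \<epsilon> j)) (\<lambda>j. of_real \<sigma>)"
  have nz0: "cmod (z0 i) = \<sigma>" for i
    using \<sigma>(1) by (cases i) (auto simp: z0_def \<epsilon>_def norm_mult)
  \<comment> \<open>Within distance \<sigma> / 6 of \<open>z0\<close>, each product \<kappa>_j moves
    by at most 2 \<sigma> (\<sigma> / 6) + (\<sigma> / 6) \<sigma> = \<sigma>^2 / 2, so half of the
    main term survives.\<close>
  have vanish: "series_eval (series_part q Hhat) (polydisc_point z) = 0"
    if z: "\<And>i. cmod (z i - z0 i) < \<sigma> / 6" for z
  proof -
    have z2: "cmod (z i) \<le> 2 * \<sigma>" for i
      using norm_triangle_sub[of "z i" "z0 i"] z[of i] nz0[of i] \<sigma>(1) by linarith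
    have f: "cmod (f k) * R ^ midx_deg k \<le> C" for k
      using bound[of 0 k] C0 by (simp add: f_def series_part_def H0)
    have \<tau>: "0 \<le> 2 * \<sigma>" "2 * \<sigma> \<le> R / 4" using \<sigma> by simp_all
    note est = flow_symbol_eval[where z = z and q = q and \<omega> = \<omega>,
        OF assms(4,5,6)[folded f_def] f R(1) \<tau> z2, folded a_def]
    have kap: "A (rvec q) $ j * Re (z (Inl j) * z (Inr j)) \<le> - (\<sigma>\<^sup>2 / 2) * \<bar>A (rvec q) $ j\<bar>" for j
    proof -
      define u where "u = z (Inl j) * z (Inr j) - z0 (Inl j) * z0 (Inr j)"
      have "u = z (Inl j) * (z (Inr j) - z0 (Inr j)) + (z (Inl j) - z0 (Inl j)) * z0 (Inr j)"
        by (simp add: u_def algebra_simps)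
      then have "cmod u \<le> cmod (z (Inl j)) * cmod (z (Inr j) - z0 (Inr j)) +
          cmod (z (Inl j) - z0 (Inl j)) * cmod (z0 (Inr j))"
        by (metis norm_mult norm_triangle_ineq)
      also have "\<dots> \<le> 2 * \<sigma> * (\<sigma> / 6) + \<sigma> / 6 * \<sigma>"
        using z[of "Inl j"] z[of "Inr j"] \<sigma>(1) nz0[of "Inr j"] z2[of "Inl j"]
        by (intro add_mono mult_mono) auto
      finally have "\<bar>Re u\<bar> \<le> \<sigma>\<^sup>2 / 2"
        using abs_Re_le_cmod[of u] by (simp add: power2_eq_square)
      then have "\<bar>A (rvec q) $ j\<bar> * \<bar>Re u\<bar> \<le> \<bar>A (rvec q) $ j\<bar> * (\<sigma>\<^sup>2 / 2)"
        by (rule mult_left_mono) simp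
      then have Au: "A (rvec q) $ j * Re u \<le> \<bar>A (rvec q) $ j\<bar> * (\<sigma>\<^sup>2 / 2)"
        unfolding abs_mult [symmetric] by linarith
      have "Re (z (Inl j) * z (Inr j)) = Re u - \<sigma>\<^sup>2 * \<epsilon> j"
        by (simp add: u_def z0_def power2_eq_square)
      then have "A (rvec q) $ j * Re (z (Inl j) * z (Inr j)) =
          A (rvec q) $ j * Re u - \<sigma>\<^sup>2 * (A (rvec q) $ j * \<epsilon> j)"
        by (simp only: right_diff_distrib mult.left_commute)
      also have "A (rvec q) $ j * \<epsilon> j = \<bar>A (rvec q) $ j\<bar>" by (simp add: \<epsilon>_def)
      also have "A (rvec q) $ j * Re u - \<sigma>\<^sup>2 * \<bar>A (rvec q) $ j\<bar> \<le>
          \<bar>A (rvec q) $ j\<bar> * (\<sigma>\<^sup>2 / 2) - \<sigma>\<^sup>2 * \<bar>A (rvec q) $ j\<bar>"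
        using Au by (rule diff_right_mono)
      also have "\<dots> = - (\<sigma>\<^sup>2 / 2) * \<bar>A (rvec q) $ j\<bar>" by (simp add: field_simps)
      finally show ?thesis .
    qed
    \<comment> \<open>In units of c \<sigma>^2 |q|, the quadratic form contributes at most - 1/2,
      while the frequency and the remainder contribute at most 1/8 each; - 1/4 is left.\<close>
    have "Re (series_eval a (polydisc_point z)) < 0"
    proof -
      define E where "E = series_eval a (polydisc_point z) - (of_real (\<omega> \<bullet> rvec q) +
        (\<Sum>i\<in>UNIV. of_real (A (rvec q) $ i) * (z (Inl i) * z (Inr i))))"
      have "cmod E \<le> l1_norm (rvec q) * (K * \<sigma>\<^sup>2 * \<sigma>\<^sup>2)"
        using est(2) by (simp add: E_def K_def G_def power2_eq_square power4_eq_xxxx field_simps)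
      also have "\<dots> \<le> l1_norm (rvec q) * (c / 8 * \<sigma>\<^sup>2)"
        using Q K\<sigma> by (intro mult_left_mono mult_right_mono) auto
      finally have E: "Re E \<le> c * \<sigma>\<^sup>2 / 8 * l1_norm (rvec q)"
        using complex_Re_le_cmod[of E] by (simp add: mult_ac)
      have "Re (series_eval a (polydisc_point z)) =
          Re E + \<omega> \<bullet> rvec q + (\<Sum>i\<in>UNIV. A (rvec q) $ i * Re (z (Inl i) * z (Inr i)))"
        by (simp add: E_def Re_sum)
      also have "(\<Sum>i\<in>UNIV. A (rvec q) $ i * Re (z (Inl i) * z (Inr i))) \<le>
          - (\<sigma>\<^sup>2 / 2) * l1_norm (A (rvec q))"
        unfolding l1_norm_def sum_distrib_left by (intro sum_mono kap)
      also have "- (\<sigma>\<^sup>2 / 2) * l1_norm (A (rvec q)) \<le> - (\<sigma>\<^sup>2 / 2) * (c * l1_norm (rvec q))"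
        using large by (intro mult_left_mono_neg) auto
      finally have "Re (series_eval a (polydisc_point z)) \<le>
          Re E + \<omega> \<bullet> rvec q + - (\<sigma>\<^sup>2 / 2) * (c * l1_norm (rvec q))" by simp
      also have "\<dots> \<le> c * \<sigma>\<^sup>2 / 8 * l1_norm (rvec q) + c * \<sigma>\<^sup>2 / 8 * l1_norm (rvec q) +
          - (\<sigma>\<^sup>2 / 2) * (c * l1_norm (rvec q))"
        using E small by linarith
      also have "\<dots> = - (c * \<sigma>\<^sup>2 / 4 * l1_norm (rvec q))" by (simp add: field_simps)
      also have "\<dots> < 0" using assms(7) \<sigma>(1) Q by simp
      finally show ?thesis .
    qed
    \<comment> \<open>The majorant uniform in time: the coefficients are bounded at radius R and
      evaluated at points of modulus at most 2 \<sigma>, with ratio at most 1 / 4.\<close>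
    moreover have "(\<lambda>k :: 'n midx. C * (2 * \<sigma> / R) ^ midx_deg k) summable_on UNIV"
      using \<sigma> R by (intro summable_on_cmult_right summable_on_power_midx_deg) (auto simp: field_simps)
    moreover have "cmod (h s k * mono_eval (polydisc_point z) k) \<le> C * (2 * \<sigma> / R) ^ midx_deg k"
      if "s \<ge> 0" for s k
    proof -
      have "cmod (h s k) \<le> C / R ^ midx_deg k"
        using bound[OF that, of k] C0 R by (simp add: h_def series_part_def field_simps)
      then have "cmod (h s k) * cmod (mono_eval (polydisc_point z) k) \<le>
          C / R ^ midx_deg k * (2 * \<sigma>) ^ midx_deg k"
        using C0 R by (intro mult_mono norm_mono_eval_le z2) auto
      then show ?thesis by (simp add: norm_mult power_divide)
    qed
    moreover have "((\<lambda>s. h s k) has_vector_derivative - series_mult a (h s) k) (at s within {0..})"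
      if "s \<ge> 0" for s k
      unfolding h_def a_def f_def by (rule flow_solution_part[OF assms(1) H assms(3) that \<omega>q])
    ultimately have "series_eval (h 0) (polydisc_point z) = 0"
      using est(1) by (intro bounded_solution_eval_eq_0)
    then show ?thesis by (simp add: h_def H0)
  qed
  have "series_part q Hhat k = 0" for k
  proof (rule series_eq_0_of_eval_eq_0[where ?z0.0 = z0 and \<eta> = "\<sigma> / 6", OF _ R(1)])
    show "cmod (series_part q Hhat k) * R ^ midx_deg k \<le> C" for k
      using bound[of 0 k] C0 by (simp add: series_part_def H0)
    show "z0 i \<noteq> 0" "cmod (z0 i) < R" for i
      using nz0[of i] \<sigma> R by auto
    show "\<sigma> / 6 > 0" using \<sigma> by simp
  qed (rule vanish)
  then have "series_part q Hhat = (\<lambda>k. 0)" by (rule ext)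
  then show False using q by (simp add: series_support_def)
qed

end
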